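(* Let $\mu>0$, $R\ge 1$ and suppose that $f\in\mathbb{R}^P$ satisfies the source condition $\|f\|_\mu\le R$. Then for every realisation of $\xi$ and all $t\in(0,d]$, $$\|A(\widehat f_t-f)\|^2\le 2R^2(\mu+1/2)^{2\mu+1}|r_t'(0)|^{-2\mu-1}+2\big\|\big((|r_t'(0)|x)^{1/2}\wedge 1\big)(AA^\top)\,\xi\big\|^2 .$$ Suppose moreover that $\lambda_i\le C_A i^{-p}$ for $i=1,\dots,D$ with some $p>1/2$ and $0<C_A<\infty$, and that $\xi=\delta Z$ with $Z\sim\mathcal N(0,I_D)$ and $\delta\in(0,1)$. Then the balanced oracle $\tau_{\mathfrak b}$ satisfies $$\mathbb{E}\big[\|A(\widehat f_{\tau_{\mathfrak b}}-f)\|^2\big]\le 4\,\mathbb{E}[S_{\tau_{\mathfrak b},\lambda}]\le C_{\mu,p,C_A}\,R^{2/(4\mu p+2p+1)}\,\delta^{(8\mu p+4p)/(4\mu p+2p+1)}$$ with a constant $C_{\mu,p,C_A}>0$ depending only on $\mu$, $p$ and $C_A$.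
   Context: Model: $D\ge 3$ and $P\ge D$ are integers, $A\in\mathbb{R}^{D\times P}$ has rank $D$, $f\in\mathbb{R}^P$, $g=Af$, $\xi\in\mathbb{R}^D$ is an error vector, and $Y=g+\xi$ is observed. $\|\cdot\|$ is the Euclidean norm, $A^\dagger=A^\top(AA^\top)^{-1}$. Let $\lambda_1\ge\dots\ge\lambda_D>0$ be the nonzero singular values of $A$ (with multiplicity), $u_i$, $v_i$ the left and right singular vectors, $\tilde\lambda_1>\dots>\tilde\lambda_d>0$ the distinct singular values. Put $Y_i=\langle Y,u_i\rangle$, $f_i=\langle f,v_i\rangle$. For a function $h$ on $[0,\infty)$ and $w\in\mathbb{R}^D$, $h(AA^\top)w=\sum_{i=1}^D h(\lambda_i^2)\langle w,u_i\rangle u_i$; an expression in $x$ followed by $(AA^\top)$ denotes the corresponding function of $x$ applied to $AA^\top$. Standing assumption: $\sum_{j:\lambda_j=\lambda_i}Y_j^2>0$ for all $i=1,\dots,D$ (this holds almost surely under Gaussian noise). Source condition: $\|f\|_\mu=\big(\sum_{i=1}^D\lambda_i^{-4\mu}f_i^2\big)^{1/2}$. Also $a\wedge b=\min(a,b)$. Interpolated conjugate gradients: for $k=0,\dots,d$, $r_k$ is the unique minimiser of $\|p(AA^\top)Y\|^2$ over real polynomials $p$ of degree at most $k$ with $p(0)=1$. For $t=k+\alpha$, $k\in\{0,\dots,d-1\}$, $\alpha\in(0,1]$, $r_t=(1-\alpha)r_k+\alpha r_{k+1}$. For $t\in[0,d]$: $\widehat f_t=A^\dagger(I_D-r_t(AA^\top))Y$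 and $R_t^2=\|A\widehat f_t-Y\|^2=\|r_t(AA^\top)Y\|^2$. For $t\in(0,d]$, $x_{1,t}$ is the smallest zero of $r_t$ on $[0,\infty)$ and $r_{t,<}(x)=r_t(x)\mathbf 1(x<x_{1,t})$; $r_{0,<}\equiv1$. Error terms: $S_{t,\lambda}=\|(1-r_{t,<})^{1/2}(AA^\top)\xi\|^2$ and $A_{t,\lambda}=\|r_{t,<}^{1/2}(AA^\top)g\|^2+R_t^2-\|r_{t,<}^{1/2}(AA^\top)Y\|^2$. Balanced oracle: $\tau_{\mathfrak b}=\inf\{t\in[0,d]: A_{t,\lambda}\le S_{t,\lambda}\}$. *)

theory Defs
  imports
    "HOL-Probability.Probability"
    "HOL-Computational_Algebra.Polynomial"
    "Jordan_Normal_Form.Matrix"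
    "Jordan_Normal_Form.Gauss_Jordan_Elimination"
    "Jordan_Normal_Form.DL_Rank"
begin

text \<open>
  The dimensions D and P are natural numbers and not types: the constant in the risk bound has
  to be chosen before D, P and the matrix. Matrices and vectors are those of
  \<open>Jordan_Normal_Form\<close>, whose components are counted from 0; singular values and singular
  vectors are families indexed by \<open>{1..D}\<close>, so that a bound on the i-th singular value
  is a bound on \<open>lam i\<close>. Values of these families outside \<open>{1..D}\<close> are never used.
\<close>

definition sq_norm2 :: "real vec \<Rightarrow> real" where
  "sq_norm2 w = scalar_prod w w"

definition pinv :: "real mat \<Rightarrow> real mat" where
  "pinv A = transpose_mat A * the (mat_inverse (A * transpose_mat A))"

definition orthonormal_family :: "nat \<Rightarrow> nat \<Rightarrow> (nat \<Rightarrow> real vec) \<Rightarrow> bool" where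
  "orthonormal_family n D w \<longleftrightarrow>
     (\<forall>i\<in>{1..D}. w i \<in> carrier_vec n) \<and>
     (\<forall>i\<in>{1..D}. \<forall>j\<in>{1..D}. scalar_prod (w i) (w j) = (if i = j then 1 else 0))"

definition singular_system ::
  "nat \<Rightarrow> nat \<Rightarrow> real mat \<Rightarrow> (nat \<Rightarrow> real) \<Rightarrow> (nat \<Rightarrow> real vec) \<Rightarrow> (nat \<Rightarrow> real vec) \<Rightarrow> bool" where
  "singular_system D P A lam u v \<longleftrightarrow>
     (\<forall>i\<in>{1..D}. lam i > 0) \<and>
     (\<forall>i\<in>{1..D}. \<forall>j\<in>{1..D}. i \<le> j \<longrightarrow> lam j \<le> lam i) \<and>
     orthonormal_family D D u \<and> orthonormal_family P D v \<and>
     (\<forall>i\<in>{1..D}. A *\<^sub>v v i = lam i \<cdot>\<^sub>v u i \<and> transpose_mat A *\<^sub>v u i = lam i \<cdot>\<^sub>v v i)"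

definition model ::
  "nat \<Rightarrow> nat \<Rightarrow> real mat \<Rightarrow> (nat \<Rightarrow> real) \<Rightarrow> (nat \<Rightarrow> real vec) \<Rightarrow> (nat \<Rightarrow> real vec) \<Rightarrow> bool" where
  "model D P A lam u v \<longleftrightarrow>
     3 \<le> D \<and> D \<le> P \<and> A \<in> carrier_mat D P \<and> vec_space.rank D A = D \<and>
     singular_system D P A lam u v"

definition num_distinct :: "nat \<Rightarrow> (nat \<Rightarrow> real) \<Rightarrow> nat" where
  "num_distinct D lam = card (lam ` {1..D})"

definition fcalc ::
  "nat \<Rightarrow> (nat \<Rightarrow> real) \<Rightarrow> (nat \<Rightarrow> real vec) \<Rightarrow> (real \<Rightarrow> real) \<Rightarrow> real vec \<Rightarrow> real vec" where \<comment> \<open>\<open>h(AA\<^sup>T) w\<close>\<close>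
  "fcalc D lam u h w =
     vec D (\<lambda>j. \<Sum>i\<in>{1..D}. h ((lam i)\<^sup>2) * scalar_prod w (u i) * vec_index (u i) j)"

definition nondegenerate :: "nat \<Rightarrow> (nat \<Rightarrow> real) \<Rightarrow> (nat \<Rightarrow> real vec) \<Rightarrow> real vec \<Rightarrow> bool" where
  "nondegenerate D lam u Y \<longleftrightarrow>
     (\<forall>i\<in>{1..D}. (\<Sum>j\<in>{j\<in>{1..D}. lam j = lam i}. (scalar_prod Y (u j))\<^sup>2) > 0)"

definition source_norm ::
  "nat \<Rightarrow> (nat \<Rightarrow> real) \<Rightarrow> (nat \<Rightarrow> real vec) \<Rightarrow> real \<Rightarrow> real vec \<Rightarrow> real" where
  "source_norm D lam v mu f =
     sqrt (\<Sum>i\<in>{1..D}. lam i powr (- 4 * mu) * (scalar_prod f (v i))\<^sup>2)"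

text \<open>
  For \<open>k \<le> num_distinct D lam\<close> the minimiser below exists and is unique as soon as
  \<open>nondegenerate D lam u Y\<close> holds; otherwise the value of \<open>THE\<close> has no meaning.
\<close>

definition cg_minimiser ::
  "nat \<Rightarrow> (nat \<Rightarrow> real) \<Rightarrow> (nat \<Rightarrow> real vec) \<Rightarrow> real vec \<Rightarrow> nat \<Rightarrow> real poly \<Rightarrow> bool" where
  "cg_minimiser D lam u Y k p \<longleftrightarrow>
     degree p \<le> k \<and> poly p 0 = 1 \<and>
     (\<forall>q. degree q \<le> k \<and> poly q 0 = 1 \<longrightarrow>
        sq_norm2 (fcalc D lam u (poly p) Y) \<le> sq_norm2 (fcalc D lam u (poly q) Y))"

definition cg_res ::
  "nat \<Rightarrow> (nat \<Rightarrow> real) \<Rightarrow> (nat \<Rightarrow> real vec) \<Rightarrow> real vec \<Rightarrow> nat \<Rightarrow> real poly" where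
  "cg_res D lam u Y k = (THE p. cg_minimiser D lam u Y k p)"

text \<open>
  For \<open>t > 0\<close> the decomposition \<open>t = k + \<alpha>\<close> with \<open>\<alpha> \<in> (0,1]\<close> forces
  \<open>k = \<lceil>t\<rceil> - 1\<close>.
\<close>

definition cg_res_interp ::
  "nat \<Rightarrow> (nat \<Rightarrow> real) \<Rightarrow> (nat \<Rightarrow> real vec) \<Rightarrow> real vec \<Rightarrow> real \<Rightarrow> real poly" where
  "cg_res_interp D lam u Y t =
     (if t = 0 then cg_res D lam u Y 0
      else let k = nat (\<lceil>t\<rceil> - 1); \<alpha> = t - real k in
        Polynomial.smult (1 - \<alpha>) (cg_res D lam u Y k) + Polynomial.smult \<alpha> (cg_res D lam u Y (k + 1)))"

definition cg_slope ::
  "nat \<Rightarrow> (nat \<Rightarrow> real) \<Rightarrow> (nat \<Rightarrow> real vec) \<Rightarrow> real vec \<Rightarrow> real \<Rightarrow> real" where \<comment> \<open>\<open>|r\<^sub>t'(0)|\<close>\<close>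
  "cg_slope D lam u Y t = \<bar>poly (pderiv (cg_res_interp D lam u Y t)) 0\<bar>"

definition cg_est ::
  "nat \<Rightarrow> real mat \<Rightarrow> (nat \<Rightarrow> real) \<Rightarrow> (nat \<Rightarrow> real vec) \<Rightarrow> real vec \<Rightarrow> real \<Rightarrow> real vec" where
  "cg_est D A lam u Y t =
     pinv A *\<^sub>v (Y - fcalc D lam u (poly (cg_res_interp D lam u Y t)) Y)"

definition resid_sq ::
  "nat \<Rightarrow> real mat \<Rightarrow> (nat \<Rightarrow> real) \<Rightarrow> (nat \<Rightarrow> real vec) \<Rightarrow> real vec \<Rightarrow> real \<Rightarrow> real" where
  "resid_sq D A lam u Y t = sq_norm2 (A *\<^sub>v cg_est D A lam u Y t - Y)"

definition first_zero ::
  "nat \<Rightarrow> (nat \<Rightarrow> real) \<Rightarrow> (nat \<Rightarrow> real vec) \<Rightarrow> real vec \<Rightarrow> real \<Rightarrow> real" where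
  "first_zero D lam u Y t = (LEAST x. 0 \<le> x \<and> poly (cg_res_interp D lam u Y t) x = 0)"

definition cg_res_trunc ::
  "nat \<Rightarrow> (nat \<Rightarrow> real) \<Rightarrow> (nat \<Rightarrow> real vec) \<Rightarrow> real vec \<Rightarrow> real \<Rightarrow> real \<Rightarrow> real" where \<comment> \<open>\<open>r\<^sub>t\<^sub>,\<^sub><\<close>\<close>
  "cg_res_trunc D lam u Y t x =
     (if t = 0 then 1
      else if x < first_zero D lam u Y t then poly (cg_res_interp D lam u Y t) x else 0)"

definition observation :: "real mat \<Rightarrow> real vec \<Rightarrow> real vec \<Rightarrow> real vec" where
  "observation A f xi = A *\<^sub>v f + xi"

definition stoch_err ::
  "nat \<Rightarrow> real mat \<Rightarrow> (nat \<Rightarrow> real) \<Rightarrow> (nat \<Rightarrow> real vec) \<Rightarrow> real vec \<Rightarrow> real vec \<Rightarrow> real \<Rightarrow> real" where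
  "stoch_err D A lam u f xi t =
     sq_norm2 (fcalc D lam u (\<lambda>x. sqrt (1 - cg_res_trunc D lam u (observation A f xi) t x)) xi)"

definition approx_err ::
  "nat \<Rightarrow> real mat \<Rightarrow> (nat \<Rightarrow> real) \<Rightarrow> (nat \<Rightarrow> real vec) \<Rightarrow> real vec \<Rightarrow> real vec \<Rightarrow> real \<Rightarrow> real" where
  "approx_err D A lam u f xi t =
     (let Y = observation A f xi; s = (\<lambda>x. sqrt (cg_res_trunc D lam u Y t x)) in
      sq_norm2 (fcalc D lam u s (A *\<^sub>v f)) + resid_sq D A lam u Y t
        - sq_norm2 (fcalc D lam u s Y))"

definition balanced_oracle ::
  "nat \<Rightarrow> real mat \<Rightarrow> (nat \<Rightarrow> real) \<Rightarrow> (nat \<Rightarrow> real vec) \<Rightarrow> real vec \<Rightarrow> real vec \<Rightarrow> real" where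
  "balanced_oracle D A lam u f xi =
     Inf {t. 0 \<le> t \<and> t \<le> real (num_distinct D lam) \<and>
             approx_err D A lam u f xi t \<le> stoch_err D A lam u f xi t}"

definition pred_loss ::
  "nat \<Rightarrow> real mat \<Rightarrow> (nat \<Rightarrow> real) \<Rightarrow> (nat \<Rightarrow> real vec) \<Rightarrow> real vec \<Rightarrow> real vec \<Rightarrow> real \<Rightarrow> real" where
  "pred_loss D A lam u f xi t =
     sq_norm2 (A *\<^sub>v (cg_est D A lam u (observation A f xi) t - f))"

text \<open>
  The standard Gaussian law on the D-dimensional Euclidean space, and the expectation of a
  non-negative function of a noise vector which is \<open>\<delta>\<close> times a standard Gaussian vector. The
  expectation takes values in \<open>[0,\<infinity>]\<close> and is unaffected by the null set on which the
  observation is degenerate.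
\<close>

definition std_gaussian :: "nat \<Rightarrow> (nat \<Rightarrow> real) measure" where
  "std_gaussian D = (\<Pi>\<^sub>M i\<in>{..<D}. density lborel (\<lambda>x. ennreal (std_normal_density x)))"

definition gauss_expect :: "nat \<Rightarrow> real \<Rightarrow> (real vec \<Rightarrow> real) \<Rightarrow> ennreal" where
  "gauss_expect D \<delta> F = (\<integral>\<^sup>+ z. ennreal (F (\<delta> \<cdot>\<^sub>v vec D z)) \<partial>std_gaussian D)"

end

theory Submission
  imports Defs "HOL-Computational_Algebra.Fundamental_Theorem_Algebra"
begin

text \<open>
  Write \<open>Y\<^sub>i\<close>, \<open>g\<^sub>i\<close>, \<open>\<xi>\<^sub>i\<close> for coordinates in the basis of the \<open>u\<^sub>i\<close> and \<open>x\<^sub>i = \<lambda>\<^sub>i\<^sup>2\<close>. For the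
  discrete inner product with weights \<open>Y\<^sub>i\<^sup>2\<close> at the nodes \<open>x\<^sub>i\<close>, the residual polynomial
  \<open>r\<^sub>k\<close> is orthogonal to \<open>x \<Pi>\<^sub>k\<^sub>-\<^sub>1\<close>, and the interpolated \<open>r\<^sub>t\<close> is orthogonal to it up to a
  multiple, of favourable sign, of the leading coefficient of the test polynomial. Testing with the
  conjugate of \<open>r\<^sub>t / (x - z)\<close> shows that every complex zero \<open>z\<close> is real and positive,
  so \<open>r\<^sub>t\<close> is a product of factors \<open>1 - x/a\<close> with \<open>a > 0\<close>. This gives
  \<open>1 - r\<^sub>t \<le> |r\<^sub>t'(0)| x\<close> and \<open>r\<^sub>t \<le> exp (- |r\<^sub>t'(0)| x)\<close> up to the first zero, and, testing with
  \<open>r\<^sub>t / (1 - x/x\<^sub>1)\<close>, that the squared residual is at most \<open>\<Sum> r\<^sub>t\<^sub>,\<^sub><(x\<^sub>i) Y\<^sub>i\<^sup>2\<close>. The prediction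
  error is at most twice the sum of the approximation and the stochastic error, coordinate by
  coordinate.

  At the oracle both error terms agree by continuity (unless the oracle is 0, where the stochastic
  error vanishes). Comparing \<open>|r\<^sub>t'(0)|\<close> there with a deterministic level \<open>\<rho>\<close> bounds the
  stochastic error by \<open>\<Sum> min (\<rho> x\<^sub>i) 1 \<xi>\<^sub>i\<^sup>2\<close> plus the bias at level \<open>\<rho>\<close>, whatever the
  noise. So only second moments enter the expectation, and \<open>\<rho> = (R/\<delta>) powr (4p/(4\<mu>p+2p+1))\<close>
  balances the two parts.
\<close>

section \<open>Polynomials with positive zeros\<close>

text \<open>The zeros form a list so that multiplicities are allowed. Each factor is 1 at the
  origin, which builds in the normalisation of a residual polynomial.\<close>

definition rprod :: "real list \<Rightarrow> real poly" where
  "rprod xs = (\<Prod>a\<leftarrow>xs. [:1, -1/a:])"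

lemma rprod_simps [simp]:
  "rprod [] = 1" "rprod (a # xs) = [:1, -1/a:] * rprod xs"
  by (simp_all add: rprod_def)

lemma poly_rprod_0 [simp]: "poly (rprod xs) 0 = 1"
  by (induction xs) simp_all

lemma poly_rprod_eq_0_iff:
  assumes "\<forall>a\<in>set xs. 0 < a"
  shows "poly (rprod xs) x = 0 \<longleftrightarrow> x \<in> set xs"
  using assms by (induction xs) (auto simp: field_simps)

text \<open>Logarithmic derivative at 0, where every factor equals 1. With positive zeros, |r'(0)|
  is therefore the sum of their reciprocals.\<close>

lemma poly_pderiv_rprod_0: "poly (pderiv (rprod xs)) 0 = - (\<Sum>a\<leftarrow>xs. 1/a)"
proof (induction xs)
  case (Cons a xs)
  show ?case
    unfolding rprod_simps pderiv_mult using Cons by (simp add: pderiv_pCons)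
qed simp

lemma rprod_remove1: "a \<in> set xs \<Longrightarrow> rprod xs = [:1, -1/a:] * rprod (remove1 a xs)"
  by (induction xs) (auto simp: mult.left_commute simp del: mult_pCons_left)

lemma degree_rprod: "\<forall>a\<in>set xs. 0 < a \<Longrightarrow> degree (rprod xs) = length xs"
proof (induction xs)
  case (Cons a xs)
  have "rprod xs \<noteq> 0"
    using poly_rprod_0[of xs] by force
  then have "degree ([:1, -1/a:] * rprod xs) = degree [:1, -1/a:] + degree (rprod xs)"
    using Cons.prems by (intro degree_mult_eq) auto
  with Cons show ?case by simp
qed simp

text \<open>The leading coefficient is the product of the numbers -1/a, so its sign alternates with
  the degree. This later fixes the sign of \<open>\<kappa>\<close> for interpolated
  residuals.\<close>

lemma sgn_lead_coeff_rprod: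
  assumes "\<forall>a\<in>set xs. 0 < a"
  shows "0 < (-1) ^ length xs * coeff (rprod xs) (length xs)"
proof -
  have "0 < (-1) ^ length xs * lead_coeff (rprod xs)"
    using assms
  proof (induction xs)
    case (Cons a xs)
    have "(-1) ^ length (a # xs) * lead_coeff (rprod (a # xs))
        = (1/a) * ((-1) ^ length xs * lead_coeff (rprod xs))"
      unfolding rprod_simps lead_coeff_mult using Cons.prems by simp
    also have "\<dots> > 0"
      using Cons by simp
    finally show ?case .
  qed simp
  then show ?thesis
    by (simp add: degree_rprod[OF assms])
qed

text \<open>Up to the smallest zero every factor lies in [0,1]. The exponential bound multiplies 1 -
  x/a \<le> exp(-x/a); the lower bound is the Weierstrass product inequality. One induction carries
  all four, since multiplying inequalities needs the range of the partial product.\<close>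

lemma rprod_bounds:
  assumes "0 \<le> x" "\<forall>a\<in>set xs. 0 < a \<and> x \<le> a"
  shows "0 \<le> poly (rprod xs) x \<and> poly (rprod xs) x \<le> 1 \<and>
    poly (rprod xs) x \<le> exp (- (x * (\<Sum>a\<leftarrow>xs. 1/a))) \<and>
    1 - x * (\<Sum>a\<leftarrow>xs. 1/a) \<le> poly (rprod xs) x"
  using assms(2)
proof (induction xs)
  case (Cons a xs)
  define r s where "r = poly (rprod xs) x" and "s = (\<Sum>a\<leftarrow>xs. 1/a)"
  have IH: "0 \<le> r" "r \<le> 1" "r \<le> exp (- (x * s))" "1 - x * s \<le> r"
    using Cons by (auto simp: r_def s_def)
  have c: "0 \<le> 1 - x/a" "1 - x/a \<le> 1"
    using Cons.prems assms(1) by auto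
  have e: "1 - x/a \<le> exp (- (x/a))"
    using exp_ge_add_one_self[of "- (x/a)"] by simp
  have "(1 - x/a) * r \<le> exp (- (x/a)) * exp (- (x * s))"
    using c e IH by (intro mult_mono) auto
  also have "\<dots> = exp (- (x * (1/a + s)))"
    by (simp add: exp_add[symmetric] algebra_simps)
  finally have 1: "(1 - x/a) * r \<le> exp (- (x * (1/a + s)))" .
  have "(1 - x/a) * r = r - x/a * r"
    by (simp add: algebra_simps)
  moreover have "x/a * r \<le> x/a * 1"
    using c IH assms(1) Cons.prems by (intro mult_left_mono) auto
  ultimately have 2: "1 - x * (1/a + s) \<le> (1 - x/a) * r"
    using IH(4) by (simp add: algebra_simps)
  have "0 \<le> (1 - x/a) * r" "(1 - x/a) * r \<le> 1"
    using c IH by (auto intro: mult_le_one)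
  moreover have "poly (rprod (a # xs)) x = (1 - x/a) * r"
    by (simp add: r_def algebra_simps)
  ultimately show ?case
    using 1 2 unfolding s_def by simp
qed simp

lemma rprod_antimono:
  assumes "0 \<le> x" "x \<le> y" "\<forall>a\<in>set xs. 0 < a \<and> y \<le> a"
  shows "poly (rprod xs) y \<le> poly (rprod xs) x"
  using assms(3)
proof (induction xs)
  case (Cons a xs)
  have "(1 - y/a) * poly (rprod xs) y \<le> (1 - x/a) * poly (rprod xs) x"
    using Cons assms rprod_bounds[of y xs]
    by (intro mult_mono) (auto simp: divide_right_mono)
  then show ?case by (simp add: algebra_simps)
qed simp

section \<open>Factorisation of a polynomial over its positive zeros\<close>

lemma map_poly_of_real_mult:
  "map_poly of_real (p * q) = (map_poly of_real p * map_poly of_real q :: complex poly)"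
  by (rule poly_eqI) (simp add: coeff_map_poly coeff_mult)

lemma poly_map_poly_of_real:
  "poly (map_poly of_real p) (of_real y) = (of_real (poly p y) :: complex)"
  by (induction p) (simp_all add: map_poly_pCons)

text \<open>At a real point a complex polynomial splits into two real ones, which can then serve as
  test polynomials for a real inner product.\<close>

lemma poly_complex_split:
  "poly Q (of_real y) = Complex (poly (map_poly Re Q) y) (poly (map_poly Im Q) y)"
proof (induction Q)
  case (pCons c Q)
  then show ?case
    by (simp add: map_poly_pCons complex_eq_iff)
qed (simp add: complex_eq_iff)

text \<open>Induction on the degree: the fundamental theorem of algebra supplies a zero, which the
  hypothesis makes real and positive. The hypothesis passes to the quotient, whose zeros are zeros
  of \<open>p\<close>.\<close>

lemma rprod_factorization:
  fixes p :: "real poly"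
  assumes "poly p 0 = 1"
    and "\<And>z::complex. poly (map_poly of_real p) z = 0 \<Longrightarrow> \<exists>a>0. z = of_real a"
  shows "\<exists>xs. length xs = degree p \<and> (\<forall>a\<in>set xs. 0 < a) \<and> p = rprod xs"
  using assms
proof (induction "degree p" arbitrary: p)
  case 0
  then obtain c where "p = [:c:]"
    by (metis degree_eq_zeroE)
  with 0 show ?case
    by (intro exI[of _ "[]"]) (auto simp: one_pCons)
next
  case (Suc n)
  have "degree (map_poly of_real p :: complex poly) = degree p"
    by (rule degree_map_poly) simp
  then have "\<not> constant (poly (map_poly of_real p :: complex poly))"
    using Suc.hyps(2) by (simp add: constant_degree)
  then obtain z :: complex where z: "poly (map_poly of_real p) z = 0"
    using fundamental_theorem_of_algebra by blast
  then obtain a where a: "0 < a" "z = of_real a"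
    using Suc.prems(2) by blast
  have "poly p a = 0"
    using z by (simp add: a poly_map_poly_of_real)
  then obtain q where q: "p = [:- a, 1:] * q"
    by (metis poly_eq_0_iff_dvd dvdE)
  \<comment> \<open>Scaling by -a turns the factor x - a into 1 - x/a, so that the quotient again
    has value 1 at 0.\<close>
  define q' where "q' = Polynomial.smult (- a) q"
  have p: "p = [:1, -1/a:] * q'"
    unfolding q q'_def using a by (simp add: smult_add_right)
  have "q' \<noteq> 0"
    using p Suc.hyps(2) by auto
  then have "degree p = degree [:1, -1/a:] + degree q'"
    unfolding p using a by (intro degree_mult_eq) auto
  then have n: "n = degree q'"
    using Suc.hyps(2) a by simp
  have "poly q' 0 = 1"
    using Suc.prems(1) p by simp
  moreover have "\<exists>a>0. y = of_real a" if "poly (map_poly of_real q') y = 0" for y :: complex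
    proof (rule Suc.prems(2))
    show "poly (map_poly of_real p) y = 0"
      unfolding p map_poly_of_real_mult poly_mult that by simp
  qed
  ultimately obtain xs where "length xs = degree q'" "\<forall>a\<in>set xs. 0 < a" "q' = rprod xs"
    using Suc.hyps(1)[OF n] by blast
  then show ?case
    using p a n Suc.hyps(2) by (intro exI[of _ "a # xs"]) auto
qed

section \<open>Truncation at the first zero\<close>

definition trunc :: "real poly \<Rightarrow> real \<Rightarrow> real" where
  "trunc r x = (if x < (LEAST y. 0 \<le> y \<and> poly r y = 0) then poly r x else 0)"

lemma least_zero_rprod:
  assumes "\<forall>a\<in>set xs. 0 < a" "xs \<noteq> []"
  shows "(LEAST y. 0 \<le> y \<and> poly (rprod xs) y = 0) = Min (set xs)"
  using assms by (intro Least_equality) (auto simp: poly_rprod_eq_0_iff)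

lemma trunc_rprod:
  assumes "\<forall>a\<in>set xs. 0 < a" "xs \<noteq> []"
  shows "trunc (rprod xs) x = (if x < Min (set xs) then poly (rprod xs) x else 0)"
  by (simp add: trunc_def least_zero_rprod[OF assms])

text \<open>Before the first zero this is \<open>rprod_bounds\<close>. From there on the truncation
  is 0, and \<open>\<phi>\<close> is at least the reciprocal of the first zero, hence
  \<open>1 \<le> \<phi> * x\<close> and the last bound remains true.\<close>

lemma trunc_bounds:
  assumes "\<forall>a\<in>set xs. 0 < a" "xs \<noteq> []" "0 \<le> x"
  defines "\<phi> \<equiv> \<Sum>a\<leftarrow>xs. 1/a"
  shows "0 \<le> trunc (rprod xs) x" "trunc (rprod xs) x \<le> 1"
    "trunc (rprod xs) x \<le> exp (- (\<phi> * x))" "1 - trunc (rprod xs) x \<le> min (\<phi> * x) 1"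
proof -
  have "0 \<le> trunc (rprod xs) x \<and> trunc (rprod xs) x \<le> 1 \<and>
    trunc (rprod xs) x \<le> exp (- (\<phi> * x)) \<and> 1 - trunc (rprod xs) x \<le> min (\<phi> * x) 1"
  proof (cases "x < Min (set xs)")
    case True
    then show ?thesis
      using rprod_bounds[of x xs] assms by (auto simp: trunc_rprod mult.commute less_imp_le)
  next
    case False
    have m: "Min (set xs) \<in> set xs"
      using assms by simp
    then have "1 / Min (set xs) \<in> set (map (\<lambda>a. 1/a) xs)"
      by simp
    then have "1 / Min (set xs) \<le> \<phi>"
      unfolding \<phi>_def using assms(1) by (intro member_le_sum_list) auto
    then have "1 / Min (set xs) * x \<le> \<phi> * x"
      using assms by (intro mult_right_mono)
    moreover have "1 \<le> 1 / Min (set xs) * x"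
      using False m assms(1) by (auto simp: field_simps)
    moreover have "trunc (rprod xs) x = 0"
      unfolding trunc_rprod[OF assms(1,2)] by (rule if_not_P[OF False])
    ultimately show ?thesis
      by simp
  qed
  then show "0 \<le> trunc (rprod xs) x" "trunc (rprod xs) x \<le> 1"
    "trunc (rprod xs) x \<le> exp (- (\<phi> * x))" "1 - trunc (rprod xs) x \<le> min (\<phi> * x) 1"
    by auto
qed

lemma compact_poly_image: "compact (poly p ` {0..x::real})"
  by (rule compact_continuous_image[OF continuous_on_poly[OF continuous_on_id] compact_Icc])

text \<open>
  The right-hand side does not mention the first zero, so continuity of \<open>r\<^sub>t\<^sub>,\<^sub><(x)\<close> in \<open>t\<close> can be
  read off without following zeros or proving that they interlace.
\<close>

lemma trunc_eq_Inf:
  assumes "\<forall>a\<in>set xs. 0 < a" "xs \<noteq> []" "0 \<le> x"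
  shows "trunc (rprod xs) x = max 0 (INF y\<in>{0..x}. poly (rprod xs) y)"
proof (cases "x < Min (set xs)")
  case True
  have "(INF y\<in>{0..x}. poly (rprod xs) y) = poly (rprod xs) x"
    using assms True by (intro cInf_eq_minimum) (auto intro!: rprod_antimono)
  then show ?thesis
    using True assms rprod_bounds[of x xs] by (auto simp: trunc_rprod less_imp_le)
next
  case False
  have "bdd_below (poly (rprod xs) ` {0..x})"
    by (intro bounded_imp_bdd_below compact_imp_bounded compact_poly_image)
  moreover have m: "Min (set xs) \<in> set xs"
    using assms by simp
  then have "Min (set xs) \<in> {0..x}" "poly (rprod xs) (Min (set xs)) = 0"
    using False assms(1) by (simp_all only: atLeastAtMost_iff poly_rprod_eq_0_iff not_less less_imp_le)
  ultimately have "(INF y\<in>{0..x}. poly (rprod xs) y) \<le> 0"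
    by (metis cINF_lower)
  then show ?thesis
    unfolding trunc_rprod[OF assms(1,2)] if_not_P[OF False] by simp
qed

text \<open>The interpolation is affine in \<open>\<alpha>\<close> with slope (q - p)(y), bounded on
  the compact interval. An infimum of functions with a common Lipschitz constant has that constant
  too.\<close>

lemma continuous_on_Inf_interp:
  fixes p q :: "real poly"
  assumes "0 \<le> x"
  shows "continuous_on UNIV
    (\<lambda>\<alpha>. INF y\<in>{0..x}. poly (Polynomial.smult (1 - \<alpha>) p + Polynomial.smult \<alpha> q) y)"
proof -
  define h where "h = (\<lambda>\<alpha>. poly (Polynomial.smult (1 - \<alpha>) p + Polynomial.smult \<alpha> q))"
  have "bounded (poly (q - p) ` {0..x})"
    by (intro compact_imp_bounded compact_poly_image)
  then obtain M where M: "0 < M" "\<And>y. y \<in> {0..x} \<Longrightarrow> \<bar>poly (q - p) y\<bar> \<le> M"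
    by (auto simp: bounded_pos)
  have bdd: "bdd_below (h \<alpha> ` {0..x})" for \<alpha>
    unfolding h_def
    by (intro bounded_imp_bdd_below compact_imp_bounded compact_poly_image)
  have le: "(INF y\<in>{0..x}. h \<alpha> y) - M * \<bar>\<alpha> - \<beta>\<bar> \<le> (INF y\<in>{0..x}. h \<beta> y)" for \<alpha> \<beta>
  proof (rule cINF_greatest)
    fix y assume y: "y \<in> {0..x}"
    have "h \<alpha> y - h \<beta> y = (\<alpha> - \<beta>) * poly (q - p) y"
      by (simp add: h_def algebra_simps)
    also have "\<dots> \<le> \<bar>\<alpha> - \<beta>\<bar> * M"
      using M(2)[OF y] by (metis abs_ge_self abs_mult abs_ge_zero mult_left_mono order_trans)
    finally have "h \<alpha> y \<le> h \<beta> y + M * \<bar>\<alpha> - \<beta>\<bar>"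
      by (simp add: algebra_simps)
    moreover have "(INF y\<in>{0..x}. h \<alpha> y) \<le> h \<alpha> y"
      using bdd y by (rule cINF_lower)
    ultimately show "(INF y\<in>{0..x}. h \<alpha> y) - M * \<bar>\<alpha> - \<beta>\<bar> \<le> h \<beta> y"
      by linarith
  qed (use assms in auto)
  have "M-lipschitz_on UNIV (\<lambda>\<alpha>. INF y\<in>{0..x}. h \<alpha> y)"
  proof (rule lipschitz_onI)
    fix \<alpha> \<beta> :: real
    show "dist (INF y\<in>{0..x}. h \<alpha> y) (INF y\<in>{0..x}. h \<beta> y) \<le> M * dist \<alpha> \<beta>"
      using le[of \<alpha> \<beta>] le[of \<beta> \<alpha>] by (simp add: dist_real_def abs_minus_commute)
  qed (use M in simp)
  then show ?thesis
    unfolding h_def by (rule lipschitz_on_continuous_on)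
qed

section \<open>Residual polynomials of a discrete measure\<close>

text \<open>A discrete measure with mass \<open>w i\<close> at \<open>x i\<close>. Indices may share
  a node and weights may vanish, since both can happen when singular values are repeated.\<close>

locale weighted_points =
  fixes I :: "'i set" and x w :: "'i \<Rightarrow> real"
  assumes fin: "finite I"
    and x_pos: "i \<in> I \<Longrightarrow> 0 < x i"
    and w_nonneg: "i \<in> I \<Longrightarrow> 0 \<le> w i"
begin

definition ip :: "real poly \<Rightarrow> real poly \<Rightarrow> real" where
  "ip p q = (\<Sum>i\<in>I. w i * poly p (x i) * poly q (x i))"

definition d :: nat where
  "d = card (x ` {i\<in>I. w i \<noteq> 0})"

lemma ip_add_left: "ip (p + q) r = ip p r + ip q r"
  by (simp add: ip_def algebra_simps sum.distrib)

lemma ip_diff_left: "ip (p - q) r = ip p r - ip q r"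
  by (simp add: ip_def algebra_simps sum_subtractf)

lemma ip_smult_left: "ip (Polynomial.smult c p) q = c * ip p q"
  by (simp add: ip_def sum_distrib_left mult_ac)

lemma ip_commute: "ip p q = ip q p"
  by (simp add: ip_def mult_ac)

lemma ip_add_right: "ip r (p + q) = ip r p + ip r q"
  by (simp add: ip_commute[of r] ip_add_left)

lemma ip_diff_right: "ip r (p - q) = ip r p - ip r q"
  by (simp add: ip_commute[of r] ip_diff_left)

lemma ip_smult_right: "ip q (Polynomial.smult c p) = c * ip q p"
  by (simp add: ip_commute[of q] ip_smult_left)

lemma ip_self_nonneg: "0 \<le> ip p p"
  unfolding ip_def mult.assoc by (intro sum_nonneg mult_nonneg_nonneg[OF w_nonneg]) auto

lemma eq_0_if_vanishes:
  assumes "degree p < d" "\<And>i. i \<in> I \<Longrightarrow> w i \<noteq> 0 \<Longrightarrow> poly p (x i) = 0"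
  shows "p = 0"
proof (rule ccontr)
  assume "p \<noteq> 0"
  have "d \<le> card {y. poly p y = 0}"
    unfolding d_def using assms(2) poly_roots_finite[OF \<open>p \<noteq> 0\<close>] by (intro card_mono) auto
  also have "\<dots> \<le> degree p"
    using \<open>p \<noteq> 0\<close> by (rule card_poly_roots_bound)
  finally show False
    using assms(1) by simp
qed

text \<open>A nonzero polynomial of degree below \<open>d\<close> cannot vanish on the whole
  support. The summand is general in order to cover squared moduli of complex polynomials as
  well.\<close>

lemma sum_pos_if_nonzero:
  fixes c :: "'i \<Rightarrow> real"
  assumes "p \<noteq> 0" "degree p < d" "\<And>i. i \<in> I \<Longrightarrow> 0 \<le> c i"
    and "\<And>i. i \<in> I \<Longrightarrow> w i \<noteq> 0 \<Longrightarrow> poly p (x i) \<noteq> 0 \<Longrightarrow> 0 < c i"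
  shows "0 < (\<Sum>i\<in>I. c i)"
proof -
  obtain i where "i \<in> I" "w i \<noteq> 0" "poly p (x i) \<noteq> 0"
    using eq_0_if_vanishes[of p] assms by blast
  then show ?thesis
    using assms(3,4) by (intro sum_pos2[OF fin, of i]) auto
qed

lemma ip_X_pos:
  assumes "p \<noteq> 0" "degree p < d"
  shows "0 < ip p (pCons 0 p)"
proof -
  have "0 < (\<Sum>i\<in>I. w i * x i * (poly p (x i))\<^sup>2)"
    using assms
    by (rule sum_pos_if_nonzero) (use x_pos w_nonneg in \<open>force simp: less_le\<close>)+
  then show ?thesis
    by (simp add: ip_def power2_eq_square mult_ac)
qed

lemma ip_XX_pos:
  assumes "p \<noteq> 0" "degree p < d"
  shows "0 < ip (pCons 0 p) (pCons 0 p)"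
proof -
  have "0 < (\<Sum>i\<in>I. w i * (x i)\<^sup>2 * (poly p (x i))\<^sup>2)"
    using assms
    by (rule sum_pos_if_nonzero) (use x_pos w_nonneg in \<open>force simp: less_le\<close>)+
  then show ?thesis
    by (simp add: ip_def power2_eq_square mult_ac)
qed

text \<open>Gram-Schmidt for the polynomials x q with deg q < k: \<open>pCons 0 s\<close> is the
  orthogonal projection of \<open>F\<close>. Vanishing of the coefficients from \<open>k\<close> on
  expresses deg q < k in a form which for k = 0 leaves only the zero polynomial.\<close>

lemma projection_exists:
  assumes "k \<le> d"
  shows "\<exists>s. (\<forall>i\<ge>k. coeff s i = 0) \<and>
    (\<forall>q. (\<forall>i\<ge>k. coeff q i = 0) \<longrightarrow> ip (F - pCons 0 s) (pCons 0 q) = 0)"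
  using assms
proof (induction k arbitrary: F)
  case 0
  have "ip (F - pCons 0 0) (pCons 0 q) = 0" if q: "\<forall>i\<ge>0. coeff q i = 0" for q
  proof -
    have "q = 0"
      by (rule poly_eqI) (simp add: q)
    then show ?thesis
      by (simp add: ip_def)
  qed
  then show ?case
    by (intro exI[of _ 0]) (simp del: pCons_0_0)
next
  case (Suc k)
  obtain s where s: "\<forall>i\<ge>k. coeff s i = 0"
    and s_orth: "\<And>q. \<forall>i\<ge>k. coeff q i = 0 \<Longrightarrow> ip (F - pCons 0 s) (pCons 0 q) = 0"
    using Suc.IH[of F] Suc.prems by auto
  obtain s' where s': "\<forall>i\<ge>k. coeff s' i = 0"
    and s'_orth: "\<And>q. \<forall>i\<ge>k. coeff q i = 0 \<Longrightarrow>
      ip (pCons 0 (Polynomial.monom 1 k) - pCons 0 s') (pCons 0 q) = 0"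
    using Suc.IH[of "pCons 0 (Polynomial.monom 1 k)"] Suc.prems by auto
  \<comment> \<open>\<open>e\<close> is monic of degree \<open>k\<close> and x e is orthogonal to
    the space already treated; it supplies the one new direction.\<close>
  define e where "e = Polynomial.monom 1 k - s'"
  have e_k: "coeff e k = 1" and e_gt: "\<forall>i>k. coeff e i = 0"
    using s' by (auto simp: e_def)
  have e_orth: "ip (pCons 0 e) (pCons 0 q) = 0" if "\<forall>i\<ge>k. coeff q i = 0" for q
    using s'_orth[OF that] by (simp add: e_def)
  have "e \<noteq> 0"
    using e_k by auto
  moreover have "degree e \<le> k"
    using e_gt by (intro degree_le) auto
  ultimately have e_pos: "0 < ip (pCons 0 e) (pCons 0 e)"
    using Suc.prems by (intro ip_XX_pos) auto
  define c where "c = ip (F - pCons 0 s) (pCons 0 e) / ip (pCons 0 e) (pCons 0 e)"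
  have step: "F - pCons 0 (s + Polynomial.smult c e) = (F - pCons 0 s) - Polynomial.smult c (pCons 0 e)"
    by simp
  show ?case
  proof (intro exI[of _ "s + Polynomial.smult c e"] conjI allI impI)
    fix i assume "Suc k \<le> i"
    then show "coeff (s + Polynomial.smult c e) i = 0"
      using s e_gt by simp
  next
    fix q :: "real poly" assume q: "\<forall>i\<ge>Suc k. coeff q i = 0"
    define q' where "q' = q - Polynomial.smult (coeff q k) e"
    have "coeff q' i = 0" if "k \<le> i" for i
      using q e_k e_gt that by (cases "i = k") (simp_all add: q'_def)
    then have q': "\<forall>i\<ge>k. coeff q' i = 0"
      by simp
    have "pCons 0 q = pCons 0 q' + Polynomial.smult (coeff q k) (pCons 0 e)"
      by (simp add: q'_def)
    then show "ip (F - pCons 0 (s + Polynomial.smult c e)) (pCons 0 q) = 0"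
      unfolding step using s_orth[OF q'] e_orth[OF q'] e_pos
      by (simp only: ip_add_right ip_smult_right ip_diff_left ip_smult_left) (simp add: c_def ip_diff_left)
  qed
qed

text \<open>Normal equations for minimising \<open>ip p p\<close> under p(0) = 1 and degree at most
  \<open>k\<close>: the admissible directions are x q with deg q < k.\<close>

definition is_res :: "nat \<Rightarrow> real poly \<Rightarrow> bool" where
  "is_res k p \<longleftrightarrow> degree p \<le> k \<and> poly p 0 = 1 \<and>
     (\<forall>q. (\<forall>i\<ge>k. coeff q i = 0) \<longrightarrow> ip p (pCons 0 q) = 0)"

lemma is_res_exists:
  assumes "k \<le> d"
  shows "\<exists>p. is_res k p"
proof -
  obtain s where s: "\<forall>i\<ge>k. coeff s i = 0"
    "\<forall>q. (\<forall>i\<ge>k. coeff q i = 0) \<longrightarrow> ip (1 - pCons 0 s) (pCons 0 q) = 0"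
    using projection_exists[OF assms] by blast
  have "degree (1 - pCons 0 s) \<le> k"
    using s(1) by (intro degree_le) (auto simp: coeff_pCons split: nat.split)
  with s show ?thesis
    unfolding is_res_def by (intro exI[of _ "1 - pCons 0 s"]) auto
qed

lemma same_value_at_0_diff:
  fixes p q :: "real poly"
  assumes "degree p \<le> k" "degree q \<le> k" "poly p 0 = poly q 0"
  obtains h where "\<forall>i\<ge>k. coeff h i = 0" "q = p + pCons 0 h"
proof -
  obtain c h where h: "q - p = pCons c h"
    by (metis pCons_cases)
  have "c = 0"
    using assms(3) arg_cong[OF h, of "\<lambda>r. poly r 0"] by simp
  moreover have "coeff h i = 0" if "k \<le> i" for i
    using that assms arg_cong[OF h, of "\<lambda>r. coeff r (Suc i)"]
    by (simp add: coeff_eq_0)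
  ultimately show ?thesis
    using that[of h] h by (metis add.commute diff_add_cancel)
qed

text \<open>Two competitors differ by some x h, to which \<open>p\<close> is orthogonal, so
  Pythagoras gives minimality. Uniqueness holds because x h has positive norm when h is nonzero of
  degree below \<open>d\<close>.\<close>

lemma is_res_minimal:
  assumes "is_res k p" "degree q \<le> k" "poly q 0 = 1"
  shows "ip p p \<le> ip q q" "k \<le> d \<Longrightarrow> ip q q = ip p p \<Longrightarrow> q = p"
proof -
  obtain h where h: "\<forall>i\<ge>k. coeff h i = 0" "q = p + pCons 0 h"
    using same_value_at_0_diff[of p k q] assms unfolding is_res_def by auto
  have "ip p (pCons 0 h) = 0"
    using assms(1) h(1) unfolding is_res_def by blast
  then have eq: "ip q q = ip p p + ip (pCons 0 h) (pCons 0 h)"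
    unfolding h(2) ip_add_left ip_add_right by (simp add: ip_commute)
  then show "ip p p \<le> ip q q"
    using ip_self_nonneg[of "pCons 0 h"] by simp
  assume "k \<le> d" "ip q q = ip p p"
  have "h = 0"
  proof (rule ccontr)
    assume "h \<noteq> 0"
    then have "degree h < k"
      using h(1) by (meson leading_coeff_0_iff not_le)
    then show False
      using ip_XX_pos[OF \<open>h \<noteq> 0\<close>] eq \<open>k \<le> d\<close> \<open>ip q q = ip p p\<close> by simp
  qed
  then show "q = p"
    using h by simp
qed

lemma minimiser_iff_is_res:
  assumes "k \<le> d"
  shows "degree p \<le> k \<and> poly p 0 = 1 \<and>
    (\<forall>q. degree q \<le> k \<and> poly q 0 = 1 \<longrightarrow> ip p p \<le> ip q q) \<longleftrightarrow> is_res k p"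
proof
  assume p: "degree p \<le> k \<and> poly p 0 = 1 \<and>
    (\<forall>q. degree q \<le> k \<and> poly q 0 = 1 \<longrightarrow> ip p p \<le> ip q q)"
  obtain r where r: "is_res k r"
    using is_res_exists[OF assms] by blast
  then have "ip p p \<le> ip r r"
    using p unfolding is_res_def by blast
  then have "p = r"
    using is_res_minimal[OF r, of p] p assms by (meson antisym)
  then show "is_res k p"
    using r by simp
qed (use is_res_minimal in \<open>auto simp: is_res_def\<close>)

lemma is_res_unique: "k \<le> d \<Longrightarrow> is_res k p \<Longrightarrow> is_res k q \<Longrightarrow> p = q"
  using minimiser_iff_is_res is_res_minimal(2) by (metis antisym)

text \<open>If the degree were smaller, \<open>p\<close> would be an admissible test polynomial for
  itself, contradicting the positivity of \<open>ip p (pCons 0 p)\<close>.\<close>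

lemma degree_is_res:
  assumes "is_res k p" "k \<le> d"
  shows "degree p = k"
proof (rule ccontr)
  assume "degree p \<noteq> k"
  then have "degree p < k"
    using assms by (simp add: is_res_def)
  then have "ip p (pCons 0 p) = 0"
    using assms by (auto simp: is_res_def coeff_eq_0)
  moreover have "p \<noteq> 0"
    using assms by (auto simp: is_res_def)
  ultimately show False
    using ip_X_pos[of p] \<open>degree p < k\<close> assms by simp
qed

section \<open>Positivity of the zeros of interpolated residuals\<close>

text \<open>
  Common form of \<open>r\<^sub>k\<^sub>+\<^sub>1\<close> (with \<open>\<kappa> = 0\<close>) and of the interpolations between \<open>r\<^sub>k\<close> and
  \<open>r\<^sub>k\<^sub>+\<^sub>1\<close>. The sign condition on \<open>\<kappa>\<close> is what keeps the zeros positive.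
\<close>

definition quasi_res :: "nat \<Rightarrow> real poly \<Rightarrow> bool" where
  "quasi_res k r \<longleftrightarrow> degree r = Suc k \<and> poly r 0 = 1 \<and>
     (\<exists>\<kappa>. \<kappa> * coeff r (Suc k) \<le> 0 \<and>
       (\<forall>q. (\<forall>i>k. coeff q i = 0) \<longrightarrow> ip r (pCons 0 q) = \<kappa> * coeff q k))"

lemma quasi_resE:
  assumes "quasi_res k r"
  obtains \<kappa> where "degree r = Suc k" "\<kappa> * coeff r (Suc k) \<le> 0"
    "\<And>q. \<forall>i>k. coeff q i = 0 \<Longrightarrow> ip r (pCons 0 q) = \<kappa> * coeff q k"
proof -
  from assms have "degree r = Suc k" and "\<exists>\<kappa>. \<kappa> * coeff r (Suc k) \<le> 0 \<and>
       (\<forall>q. (\<forall>i>k. coeff q i = 0) \<longrightarrow> ip r (pCons 0 q) = \<kappa> * coeff q k)"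
    unfolding quasi_res_def by auto
  then show ?thesis
    by (elim exE conjE) (rule that, auto)
qed

lemma quasi_res_if_is_res: "is_res (Suc k) p \<Longrightarrow> Suc k \<le> d \<Longrightarrow> quasi_res k p"
  using degree_is_res[of "Suc k" p] unfolding quasi_res_def is_res_def
  by (auto intro!: exI[of _ 0] simp: Suc_le_eq)

text \<open>With r = (x - z) Q, testing with the real and imaginary parts of \<open>Q\<close> brings
  in r conj(Q) = (x - z)|Q|^2. The imaginary part forces Im z = 0; the real part gives
  \<open>M - a * N\<close> = \<open>\<kappa> * l\<close> \<le> 0 with \<open>M\<close> and
  \<open>N\<close> positive, hence a > 0.\<close>

lemma quasi_res_root_pos:
  fixes z :: complex
  assumes "quasi_res k r" "k < d" "poly (map_poly of_real r) z = 0"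
  shows "\<exists>a>0. z = of_real a"
proof -
  let ?R = "map_poly of_real r :: complex poly"
  define l where "l = coeff r (Suc k)"
  obtain \<kappa> where deg: "degree r = Suc k" and \<kappa>: "\<kappa> * l \<le> 0"
    "\<And>q. \<forall>i>k. coeff q i = 0 \<Longrightarrow> ip r (pCons 0 q) = \<kappa> * coeff q k"
    unfolding l_def by (rule quasi_resE[OF assms(1)]) blast
  obtain Q where Q: "?R = [:- z, 1:] * Q"
    using assms(3) by (metis poly_eq_0_iff_dvd dvdE)
  have degR: "degree ?R = Suc k"
    using deg by (simp add: degree_map_poly)
  then have "Q \<noteq> 0"
    using Q by auto
  then have "degree ?R = degree [:- z, 1:] + degree Q"
    unfolding Q by (intro degree_mult_eq) auto
  then have degQ: "degree Q = k"
    using degR by simp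
  \<comment> \<open>The leading coefficient of \<open>Q\<close> is that of \<open>r\<close>, hence
    real. So the imaginary part of \<open>Q\<close> has no term of degree \<open>k\<close>, and
    \<open>\<kappa>\<close> does not enter when testing with it.\<close>
  have "coeff ?R (Suc k) = coeff Q k"
    unfolding Q using degQ by (simp add: coeff_eq_0)
  then have leadQ: "coeff Q k = of_real l"
    by (simp add: coeff_map_poly l_def)
  define q1 q2 where "q1 = map_poly Re Q" and "q2 = map_poly Im Q"
  define a b where "a = Re z" and "b = Im z"
  have q1: "\<forall>i>k. coeff q1 i = 0" "coeff q1 k = l" and q2: "\<forall>i>k. coeff q2 i = 0" "coeff q2 k = 0"
    using degQ leadQ by (auto simp: q1_def q2_def coeff_map_poly coeff_eq_0)
  have "l \<noteq> 0"
    using deg unfolding l_def by (metis leading_coeff_0_iff degree_0 nat.distinct(1))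
  then have "q1 \<noteq> 0"
    using q1 by auto
  have degq1: "degree q1 < d"
    using assms(2) q1(1) by (metis degree_le le_less_trans)
  define f1 f2 where "f1 = (\<lambda>i. poly q1 (x i))" and "f2 = (\<lambda>i. poly q2 (x i))"
  have rx: "poly r (x i) = (x i - a) * f1 i + b * f2 i" "(x i - a) * f2 i = b * f1 i" for i
  proof -
    have "of_real (poly r (x i)) = (of_real (x i) - z) * Complex (f1 i) (f2 i)"
      unfolding poly_map_poly_of_real[symmetric] Q q1_def q2_def f1_def f2_def
        poly_complex_split[symmetric] by (simp add: algebra_simps)
    then show "poly r (x i) = (x i - a) * f1 i + b * f2 i" "(x i - a) * f2 i = b * f1 i"
      by (auto simp: complex_eq_iff a_def b_def algebra_simps)
  qed
  have r1: "poly r (x i) * f1 i = (x i - a) * ((f1 i)\<^sup>2 + (f2 i)\<^sup>2)"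
    and r2: "poly r (x i) * f2 i = b * ((f1 i)\<^sup>2 + (f2 i)\<^sup>2)" for i
  proof -
    have "poly r (x i) * f1 i = (x i - a) * (f1 i)\<^sup>2 + (b * f1 i) * f2 i"
      unfolding rx(1) by (simp add: power2_eq_square algebra_simps)
    then show "poly r (x i) * f1 i = (x i - a) * ((f1 i)\<^sup>2 + (f2 i)\<^sup>2)"
      unfolding rx(2)[symmetric] by (simp add: power2_eq_square algebra_simps)
    have "poly r (x i) * f2 i = ((x i - a) * f2 i) * f1 i + b * (f2 i)\<^sup>2"
      unfolding rx(1) by (simp add: power2_eq_square algebra_simps)
    then show "poly r (x i) * f2 i = b * ((f1 i)\<^sup>2 + (f2 i)\<^sup>2)"
      unfolding rx(2) by (simp add: power2_eq_square algebra_simps)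
  qed
  define N where "N = (\<Sum>i\<in>I. w i * x i * ((f1 i)\<^sup>2 + (f2 i)\<^sup>2))"
  define M where "M = (\<Sum>i\<in>I. w i * (x i)\<^sup>2 * ((f1 i)\<^sup>2 + (f2 i)\<^sup>2))"
  have "0 < N"
    unfolding N_def using \<open>q1 \<noteq> 0\<close> degq1
  proof (rule sum_pos_if_nonzero)
    fix i assume i: "i \<in> I" "w i \<noteq> 0" "poly q1 (x i) \<noteq> 0"
    then have "0 < w i" "0 < x i"
      using w_nonneg[of i] x_pos[of i] by auto
    moreover have "0 < (f1 i)\<^sup>2 + (f2 i)\<^sup>2"
      using i by (intro add_pos_nonneg) (auto simp: f1_def)
    ultimately show "0 < w i * x i * ((f1 i)\<^sup>2 + (f2 i)\<^sup>2)"
      by simp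
  qed (simp add: w_nonneg x_pos less_imp_le)
  have "0 < M"
    unfolding M_def using \<open>q1 \<noteq> 0\<close> degq1
  proof (rule sum_pos_if_nonzero)
    fix i assume i: "i \<in> I" "w i \<noteq> 0" "poly q1 (x i) \<noteq> 0"
    then have "0 < w i" "0 < x i"
      using w_nonneg[of i] x_pos[of i] by auto
    moreover have "0 < (f1 i)\<^sup>2 + (f2 i)\<^sup>2"
      using i by (intro add_pos_nonneg) (auto simp: f1_def)
    ultimately show "0 < w i * (x i)\<^sup>2 * ((f1 i)\<^sup>2 + (f2 i)\<^sup>2)"
      by simp
  qed (simp add: w_nonneg)
  have "0 = ip r (pCons 0 q2)"
    using \<kappa>(2)[OF q2(1)] q2(2) by simp
  also have "\<dots> = (\<Sum>i\<in>I. w i * x i * (poly r (x i) * f2 i))"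
    by (simp add: ip_def f2_def mult_ac)
  also have "\<dots> = b * N"
    unfolding r2 N_def by (simp add: sum_distrib_left mult_ac)
  finally have "b = 0"
    using \<open>0 < N\<close> by simp
  have "\<kappa> * l = ip r (pCons 0 q1)"
    using \<kappa>(2)[OF q1(1)] q1(2) by simp
  also have "\<dots> = (\<Sum>i\<in>I. w i * x i * (poly r (x i) * f1 i))"
    by (simp add: ip_def f1_def mult_ac)
  also have "\<dots> = M - a * N"
    unfolding r1 N_def M_def sum_distrib_left sum_subtractf[symmetric]
    by (intro sum.cong refl) (simp add: power2_eq_square algebra_simps)
  finally have "0 < a * N"
    using \<kappa>(1) \<open>0 < M\<close> by simp
  then have "0 < a"
    using \<open>0 < N\<close> by (simp add: zero_less_mult_iff)
  then show ?thesis
    using \<open>b = 0\<close> by (intro exI[of _ a]) (auto simp: complex_eq_iff a_def b_def)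
qed

lemma quasi_res_rprod:
  assumes "quasi_res k r" "k < d"
  obtains xs where "length xs = Suc k" "\<forall>a\<in>set xs. 0 < a" "r = rprod xs"
proof -
  have "degree r = Suc k" "poly r 0 = 1"
    using assms(1) by (auto simp: quasi_res_def)
  then show ?thesis
    using rprod_factorization[of r] quasi_res_root_pos[OF assms] that by auto
qed

lemma sgn_lead_coeff_is_res:
  assumes "is_res k p" "k \<le> d"
  shows "0 < (-1) ^ k * coeff p k"
proof (cases k)
  case 0
  have "degree p = 0" "poly p 0 = 1"
    using assms(1) 0 by (auto simp: is_res_def)
  then have "coeff p 0 = 1"
    by (simp add: poly_0_coeff_0)
  then show ?thesis
    by (simp add: 0)
next
  case (Suc n)
  then obtain xs where "length xs = k" "\<forall>a\<in>set xs. 0 < a" "p = rprod xs"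
    using quasi_res_rprod[OF quasi_res_if_is_res[of n p]] assms by auto
  then show ?thesis
    using sgn_lead_coeff_rprod by blast
qed

text \<open>For h of degree at most \<open>k\<close>, \<open>q\<close> is orthogonal to x h, and
  \<open>p\<close> sees only the component of h along \<open>p\<close> itself. The result is a
  multiple of the top coefficient of h; its sign is favourable because the leading coefficients of
  \<open>p\<close> and \<open>q\<close> have opposite signs.\<close>

lemma quasi_res_interp:
  assumes p: "is_res k p" and q: "is_res (Suc k) q" and k: "Suc k \<le> d"
    and \<alpha>: "0 < \<alpha>" "\<alpha> \<le> 1"
  shows "quasi_res k (Polynomial.smult (1 - \<alpha>) p + Polynomial.smult \<alpha> q)" (is "quasi_res k ?r")
proof -
  have sp: "0 < (-1) ^ k * coeff p k"
    using sgn_lead_coeff_is_res[OF p] k by simp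
  have sq: "0 < (-1) ^ Suc k * coeff q (Suc k)"
    using sgn_lead_coeff_is_res[OF q k] .
  have pk: "coeff p k \<noteq> 0" "coeff p (Suc k) = 0"
    using sp p by (auto simp: is_res_def coeff_eq_0)
  have qk: "coeff q (Suc k) \<noteq> 0"
    using sq by auto
  have neg: "coeff q (Suc k) / coeff p k \<le> 0"
    using sp sq by (cases "even k") (auto simp: divide_le_0_iff)
  have r_lead: "coeff ?r (Suc k) = \<alpha> * coeff q (Suc k)"
    using pk by simp
  have "degree ?r \<le> Suc k"
    using p q by (intro degree_add_le order.trans[OF degree_smult_le]) (auto simp: is_res_def)
  then have deg: "degree ?r = Suc k"
    using r_lead qk \<alpha> by (intro antisym le_degree) auto
  define P where "P = ip p (pCons 0 p)"
  have "p \<noteq> 0"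
    using pk by auto
  then have "0 < P"
    unfolding P_def using degree_is_res[OF p] k by (intro ip_X_pos) auto
  \<comment> \<open>\<open>P / coeff p k\<close> converts the top coefficient of a test polynomial h
    into the pairing of \<open>p\<close> with x h.\<close>
  define \<kappa> where "\<kappa> = (1 - \<alpha>) * P / coeff p k"
  have "\<kappa> * coeff ?r (Suc k) = ((1 - \<alpha>) * P * \<alpha>) * (coeff q (Suc k) / coeff p k)"
    unfolding r_lead \<kappa>_def by simp
  also have "\<dots> \<le> 0"
    using neg \<open>0 < P\<close> \<alpha> by (intro mult_nonneg_nonpos) auto
  finally have "\<kappa> * coeff ?r (Suc k) \<le> 0" .
  moreover have "ip ?r (pCons 0 h) = \<kappa> * coeff h k" if h: "\<forall>i>k. coeff h i = 0" for h
  proof -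
    define c where "c = coeff h k / coeff p k"
    define h' where "h' = h - Polynomial.smult c p"
    have "\<forall>i\<ge>k. coeff h' i = 0"
      using h pk degree_is_res[OF p] k by (auto simp: h'_def c_def le_less coeff_eq_0)
    then have "ip p (pCons 0 h') = 0"
      using p by (auto simp: is_res_def)
    moreover have "pCons 0 h = pCons 0 h' + Polynomial.smult c (pCons 0 p)"
      by (simp add: h'_def)
    ultimately have "ip p (pCons 0 h) = c * P"
      unfolding P_def by (simp only: ip_add_right ip_smult_right)
    moreover have "ip q (pCons 0 h) = 0"
      using q h by (auto simp: is_res_def Suc_le_eq)
    ultimately show ?thesis
      by (simp add: ip_add_left ip_smult_left \<kappa>_def c_def)
  qed
  moreover have "poly ?r 0 = 1"
    using p q by (simp add: is_res_def)
  ultimately show ?thesis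
    using deg unfolding quasi_res_def by blast
qed

text \<open>Test with p = r / (1 - x/m), where \<open>m\<close> is the first zero. Since r = p -
  (x/m) p and the sign of \<open>\<kappa>\<close> makes \<open>ip r (pCons 0 p)\<close> nonnegative,
  \<open>ip r r \<le> ip r p\<close>. Before \<open>m\<close>, r p \<le> r because 0 \<le> p \<le>
  1; from \<open>m\<close> on, r p = (1 - x/m) p^2 \<le> 0.\<close>

lemma ip_self_le_trunc:
  assumes "quasi_res k r" "k < d"
  shows "ip r r \<le> (\<Sum>i\<in>I. w i * trunc r (x i))"
proof -
  obtain xs where xs: "length xs = Suc k" "\<forall>a\<in>set xs. 0 < a" "r = rprod xs"
    using quasi_res_rprod[OF assms] .
  define m where "m = Min (set xs)"
  have ne: "xs \<noteq> []"
    using xs(1) by auto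
  then have m: "m \<in> set xs"
    unfolding m_def by simp
  then have "0 < m"
    using xs by blast
  define ys where "ys = remove1 m xs"
  have "set ys \<subseteq> set xs"
    unfolding ys_def by (rule set_remove1_subset)
  then have ys: "\<forall>a\<in>set ys. 0 < a \<and> m \<le> a"
    using xs(2) unfolding m_def by (auto intro!: Min_le)
  define p where "p = rprod ys"
  have r: "r = [:1, -1/m:] * p"
    unfolding xs(3) p_def ys_def by (rule rprod_remove1[OF m])
  have "length ys = k"
    using xs(1) m by (simp add: ys_def length_remove1)
  then have degp: "degree p = k"
    using ys degree_rprod[of ys] unfolding p_def by auto
  obtain \<kappa> where \<kappa>: "\<kappa> * coeff r (Suc k) \<le> 0"
    "\<And>q. \<forall>i>k. coeff q i = 0 \<Longrightarrow> ip r (pCons 0 q) = \<kappa> * coeff q k"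
    by (rule quasi_resE[OF assms(1)]) blast
  have "coeff r (Suc k) = - (coeff p k / m)"
    unfolding r using degp by (simp add: coeff_eq_0)
  moreover have "ip r (pCons 0 p) = \<kappa> * coeff p k"
    using degp by (intro \<kappa>(2)) (auto simp: coeff_eq_0)
  ultimately have "0 \<le> (1/m) * ip r (pCons 0 p)"
    using \<kappa>(1) by simp
  moreover have "r = p - Polynomial.smult (1/m) (pCons 0 p)"
    unfolding r by simp
  then have "ip r r = ip r p - (1/m) * ip r (pCons 0 p)"
    by (metis ip_diff_right ip_smult_right)
  ultimately have "ip r r \<le> ip r p"
    by simp
  also have "\<dots> \<le> (\<Sum>i\<in>I. w i * trunc r (x i))"
    unfolding ip_def
  proof (rule sum_mono)
    fix i assume i: "i \<in> I"
    have rp: "poly r (x i) = (1 - x i / m) * poly p (x i)"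
      unfolding r by (simp add: algebra_simps)
    show "w i * poly r (x i) * poly p (x i) \<le> w i * trunc r (x i)"
    proof (cases "x i < m")
      case True
      have "0 \<le> poly p (x i)" "poly p (x i) \<le> 1"
        using rprod_bounds[of "x i" ys] ys True x_pos[OF i] by (force simp: p_def)+
      moreover have "0 \<le> 1 - x i / m"
        using True \<open>0 < m\<close> by simp
      ultimately have "poly r (x i) * poly p (x i) \<le> poly r (x i) * 1"
        unfolding rp by (intro mult_left_mono) auto
      moreover have "trunc r (x i) = poly r (x i)"
        using True xs(2) ne by (simp add: xs(3) trunc_rprod m_def)
      ultimately show ?thesis
        using w_nonneg[OF i] by (simp add: mult.assoc mult_left_mono)
    next
      case False
      have "(1 - x i / m) * (poly p (x i))\<^sup>2 \<le> 0"
        using False \<open>0 < m\<close> by (intro mult_nonpos_nonneg) auto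
      then have "poly r (x i) * poly p (x i) \<le> 0"
        unfolding rp by (simp add: power2_eq_square mult_ac)
      moreover have "trunc r (x i) = 0"
        unfolding xs(3) trunc_rprod[OF xs(2) ne] using False unfolding m_def by (rule if_not_P)
      ultimately show ?thesis
        using w_nonneg[OF i] by (simp add: mult.assoc mult_nonneg_nonpos)
    qed
  qed
  finally show ?thesis .
qed

text \<open>The product of 1 - x/a over the support has degree at most \<open>d\<close> and zero
  norm, so the minimal norm is zero and \<open>p\<close> vanishes wherever there is mass.\<close>

lemma is_res_d_vanishes:
  assumes "is_res d p" "i \<in> I" "w i \<noteq> 0"
  shows "poly p (x i) = 0"
proof -
  define S where "S = x ` {i\<in>I. w i \<noteq> 0}"
  define q where "q = (\<Prod>a\<in>S. [:1, -1/a:])"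
  have "finite S"
    unfolding S_def using fin by simp
  have q0: "poly q 0 = 1"
    by (simp add: q_def poly_prod)
  have "degree q \<le> (\<Sum>a\<in>S. degree [:1, -1/a:])"
    unfolding q_def by (rule order.trans[OF degree_prod_sum_le[OF \<open>finite S\<close>]]) (simp add: comp_def)
  also have "\<dots> \<le> d"
    unfolding d_def S_def[symmetric] by (rule order.trans[OF sum_mono[of _ _ "\<lambda>_. 1"]]) auto
  finally have deg: "degree q \<le> d" .
  have "poly q (x j) = 0" if "j \<in> I" "w j \<noteq> 0" for j
    unfolding q_def poly_prod using that \<open>finite S\<close> x_pos[of j]
    by (intro prod_zero bexI[of _ "x j"]) (auto simp: S_def)
  then have "ip q q = 0"
    unfolding ip_def by (intro sum.neutral ballI) auto
  then have "ip p p = 0"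
    using is_res_minimal(1)[OF assms(1) deg q0] ip_self_nonneg[of p] by simp
  then have "w i * poly p (x i) * poly p (x i) = 0"
    unfolding ip_def using fin assms(2)
    by (subst (asm) sum_nonneg_eq_0_iff) (auto simp: w_nonneg mult.assoc)
  then show ?thesis
    using assms(3) by simp
qed

end

section \<open>Spectral calculus\<close>

text \<open>A square matrix with orthonormal rows has orthonormal columns as well.\<close>

lemma orthonormal_completeness:
  assumes "orthonormal_family D D u" "a < D" "b < D"
  shows "(\<Sum>i\<in>{1..D}. vec_index (u i) a * vec_index (u i) b) = (if a = b then 1 else 0)"
proof -
  \<comment> \<open>The shift by \<open>Suc\<close> matches the family on \<open>{1..D}\<close> with
    rows counted from 0.\<close>
  define U where "U = mat D D (\<lambda>(i, j). vec_index (u (Suc i)) j)"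
  have U: "U \<in> carrier_mat D D"
    by (simp add: U_def)
  have u: "dim_vec (u i) = D" if "i \<in> {1..D}" for i
    using assms(1) that by (auto simp: orthonormal_family_def)
  have row: "row U i = u (Suc i)" if "i < D" for i
    using that u[of "Suc i"] by (intro eq_vecI) (auto simp: U_def)
  have "U * transpose_mat U = 1\<^sub>m D"
  proof (rule eq_matI)
    fix i j assume "i < dim_row (1\<^sub>m D :: real mat)" "j < dim_col (1\<^sub>m D :: real mat)"
    then have ij: "i < D" "j < D"
      by auto
    then have "(U * transpose_mat U) $$ (i, j) = scalar_prod (u (Suc i)) (u (Suc j))"
      using U by (simp add: row)
    then show "(U * transpose_mat U) $$ (i, j) = 1\<^sub>m D $$ (i, j)"
      using assms(1) ij by (simp add: orthonormal_family_def)
  qed (use U in auto)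
  then have "transpose_mat U * U = 1\<^sub>m D"
    using U by (intro mat_mult_left_right_inverse[of U D "transpose_mat U"]) simp_all
  then have "(transpose_mat U * U) $$ (a, b) = (if a = b then 1 else 0)"
    using assms by simp
  moreover have "(transpose_mat U * U) $$ (a, b) = (\<Sum>i<D. vec_index (u (Suc i)) a * vec_index (u (Suc i)) b)"
    using assms(2,3) by (simp add: scalar_prod_def U_def lessThan_atLeast0)
  also have "\<dots> = (\<Sum>i\<in>{1..D}. vec_index (u i) a * vec_index (u i) b)"
    by (rule sum.reindex_bij_witness[of _ "\<lambda>i. i - 1" Suc]) auto
  finally show ?thesis
    by simp
qed

lemma parseval:
  assumes u: "orthonormal_family D D u" and w: "w \<in> carrier_vec D" "w' \<in> carrier_vec D"
  shows "scalar_prod w w' = (\<Sum>i\<in>{1..D}. scalar_prod w (u i) * scalar_prod w' (u i))"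
proof -
  have dim: "dim_vec (u i) = D" if "i \<in> {1..D}" for i
    using u that by (auto simp: orthonormal_family_def)
  have "(\<Sum>i\<in>{1..D}. scalar_prod w (u i) * scalar_prod w' (u i))
      = (\<Sum>i\<in>{1..D}. \<Sum>a<D. \<Sum>b<D. vec_index w a * vec_index w' b * (vec_index (u i) a * vec_index (u i) b))"
    by (intro sum.cong refl)
      (simp add: scalar_prod_def dim sum_product lessThan_atLeast0[symmetric] mult_ac)
  also have "\<dots> = (\<Sum>a<D. \<Sum>i\<in>{1..D}. \<Sum>b<D. vec_index w a * vec_index w' b * (vec_index (u i) a * vec_index (u i) b))"
    by (rule sum.swap)
  also have "\<dots> = (\<Sum>a<D. \<Sum>b<D. \<Sum>i\<in>{1..D}. vec_index w a * vec_index w' b * (vec_index (u i) a * vec_index (u i) b))"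
    by (intro sum.cong refl sum.swap)
  also have "\<dots> = (\<Sum>a<D. \<Sum>b<D. vec_index w a * vec_index w' b *
      (\<Sum>i\<in>{1..D}. vec_index (u i) a * vec_index (u i) b))"
    by (simp only: sum_distrib_left)
  also have "\<dots> = (\<Sum>a<D. \<Sum>b<D. if a = b then vec_index w a * vec_index w' b else 0)"
  proof (intro sum.cong refl)
    fix a b assume "a \<in> {..<D}" "b \<in> {..<D}"
    then show "vec_index w a * vec_index w' b * (\<Sum>i\<in>{1..D}. vec_index (u i) a * vec_index (u i) b)
        = (if a = b then vec_index w a * vec_index w' b else 0)"
      using orthonormal_completeness[OF u, of a b] by (simp del: One_nat_def)
  qed
  also have "\<dots> = scalar_prod w w'"
    using w by (simp add: scalar_prod_def lessThan_atLeast0)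
  finally show ?thesis
    by simp
qed

lemma fcalc_carrier [simp]: "fcalc D lam u h w \<in> carrier_vec D"
  by (simp add: fcalc_def)

lemma fcalc_component:
  assumes u: "orthonormal_family D D u" and j: "j \<in> {1..D}"
  shows "scalar_prod (fcalc D lam u h w) (u j) = h ((lam j)\<^sup>2) * scalar_prod w (u j)"
proof -
  have dim: "dim_vec (u i) = D" if "i \<in> {1..D}" for i
    using u that by (auto simp: orthonormal_family_def)
  have "scalar_prod (fcalc D lam u h w) (u j)
      = (\<Sum>a<D. \<Sum>i\<in>{1..D}. h ((lam i)\<^sup>2) * scalar_prod w (u i) * (vec_index (u i) a * vec_index (u j) a))"
    using dim[OF j] unfolding scalar_prod_def[of _ "u j"] fcalc_def lessThan_atLeast0
    by (intro sum.cong) (simp_all add: sum_distrib_right mult.assoc)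
  also have "\<dots> = (\<Sum>i\<in>{1..D}. h ((lam i)\<^sup>2) * scalar_prod w (u i) * scalar_prod (u i) (u j))"
    using dim[OF j]
    by (subst sum.swap) (simp add: scalar_prod_def[of _ "u j"] lessThan_atLeast0 sum_distrib_left)
  also have "\<dots> = (\<Sum>i\<in>{1..D}. if i = j then h ((lam i)\<^sup>2) * scalar_prod w (u i) else 0)"
    using u j by (intro sum.cong refl) (auto simp: orthonormal_family_def)
  finally show ?thesis
    using j by simp
qed

lemma sq_norm2_parseval:
  "orthonormal_family D D u \<Longrightarrow> w \<in> carrier_vec D \<Longrightarrow>
    sq_norm2 w = (\<Sum>i\<in>{1..D}. (scalar_prod w (u i))\<^sup>2)"
  by (simp add: sq_norm2_def parseval power2_eq_square)

lemma sq_norm2_fcalc: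
  assumes u: "orthonormal_family D D u"
  shows "sq_norm2 (fcalc D lam u h w) = (\<Sum>i\<in>{1..D}. (h ((lam i)\<^sup>2) * scalar_prod w (u i))\<^sup>2)"
  unfolding sq_norm2_parseval[OF u fcalc_carrier]
  by (intro sum.cong refl) (simp add: fcalc_component[OF u])

text \<open>The inverse in \<open>pinv\<close> exists because \<open>M\<close> has trivial kernel:
  pairing \<open>M\<close> z = 0 with \<open>u i\<close> gives the squared singular value times a
  coordinate of z. All coordinates vanish, so z = 0 by Parseval.\<close>

lemma mult_pinv_vec:
  assumes m: "model D P A lam u v" and y: "y \<in> carrier_vec D"
  shows "A *\<^sub>v (pinv A *\<^sub>v y) = y"
proof -
  have A: "A \<in> carrier_mat D P" and s: "singular_system D P A lam u v"
    using m by (auto simp: model_def)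
  then have u: "orthonormal_family D D u" and v: "orthonormal_family P D v"
    by (auto simp: singular_system_def)
  define M where "M = A * transpose_mat A"
  have M: "M \<in> carrier_mat D D"
    using A by (simp add: M_def)
  have AT: "transpose_mat A \<in> carrier_mat P D"
    using A by simp
  have "det M \<noteq> 0"
  proof
    assume "det M = 0"
    then obtain z where z: "z \<in> carrier_vec D" "z \<noteq> 0\<^sub>v D" "M *\<^sub>v z = 0\<^sub>v D"
      using det_0_iff_vec_prod_zero_field[OF M] by blast
    have "scalar_prod z (u i) = 0" if i: "i \<in> {1..D}" for i
    proof -
      have ui: "u i \<in> carrier_vec D" and vi: "v i \<in> carrier_vec P"
        using u v i by (auto simp: orthonormal_family_def)
      have lam: "0 < lam i" "A *\<^sub>v v i = lam i \<cdot>\<^sub>v u i" "transpose_mat A *\<^sub>v u i = lam i \<cdot>\<^sub>v v i"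
        using s i by (auto simp: singular_system_def)
      have ATz: "transpose_mat A *\<^sub>v z \<in> carrier_vec P"
        using AT z(1) by simp
      have "A *\<^sub>v (transpose_mat A *\<^sub>v z) = 0\<^sub>v D"
        using z A AT by (metis M_def assoc_mult_mat_vec)
      then have "0 = scalar_prod (u i) (A *\<^sub>v (transpose_mat A *\<^sub>v z))"
        using ui by simp
      also have "\<dots> = scalar_prod (transpose_mat A *\<^sub>v u i) (transpose_mat A *\<^sub>v z)"
        using transpose_vec_mult_scalar[OF A ATz ui] by simp
      also have "\<dots> = lam i * scalar_prod (transpose_mat A *\<^sub>v z) (v i)"
        unfolding lam using vi ATz by (simp add: scalar_prod_smult_left comm_scalar_prod[of _ P])
      also have "\<dots> = lam i * scalar_prod z (lam i \<cdot>\<^sub>v u i)"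
        using transpose_vec_mult_scalar[OF A vi z(1)] lam by simp
      finally show ?thesis
        using lam(1) z(1) ui by (simp add: scalar_prod_smult_right)
    qed
    then have "scalar_prod z z = 0"
      using parseval[OF u z(1) z(1)] by simp
    then have "vec_index z a = 0" if "a < D" for a
      using that z(1) unfolding scalar_prod_def
      by (subst (asm) sum_nonneg_eq_0_iff) auto
    then show False
      using z(1,2) by (metis carrier_vecD eq_vecI index_zero_vec)
  qed
  then have "M \<in> Units (ring_mat TYPE(real) D ())"
    by (rule det_non_zero_imp_unit[OF M])
  then obtain B where "mat_inverse M = Some B"
    using mat_inverse(1)[OF M, of "()"] by (cases "mat_inverse M") auto
  then have B: "M * B = 1\<^sub>m D" "B \<in> carrier_mat D D" "pinv A = transpose_mat A * B"
    using mat_inverse(2)[OF M] by (auto simp: pinv_def M_def)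
  have "A *\<^sub>v (pinv A *\<^sub>v y) = A *\<^sub>v (transpose_mat A *\<^sub>v (B *\<^sub>v y))"
    unfolding B(3) using AT B(2) y by (simp add: assoc_mult_mat_vec[of _ P D _ D])
  also have "\<dots> = M *\<^sub>v (B *\<^sub>v y)"
    unfolding M_def using A AT B(2) y by (simp add: assoc_mult_mat_vec[of _ D P _ D])
  also have "\<dots> = (M * B) *\<^sub>v y"
    using M B(2) y by (simp add: assoc_mult_mat_vec[of _ D D _ D])
  finally show ?thesis
    using B(1) y by simp
qed

lemma pinv_carrier:
  "A \<in> carrier_mat D P \<Longrightarrow> dim_row (pinv A) = P"
  by (simp add: pinv_def)

section \<open>Real inequalities and Gaussian expectations\<close>

lemma two_mult_le_exp: "0 \<le> y \<Longrightarrow> 2 * y \<le> exp (y::real)"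
proof -
  assume "0 \<le> y"
  have "0 \<le> (y - 1)\<^sup>2"
    by simp
  then have "2 * y \<le> 1 + y + y\<^sup>2 / 2"
    by (simp add: power2_eq_square algebra_simps)
  also have "\<dots> \<le> exp y"
    by (rule exp_lower_Taylor_quadratic) fact
  finally show ?thesis .
qed

text \<open>Uses 2 y \<le> exp y at y = \<open>\<phi> * x / s\<close>. The factor 2, rather than the
  optimal e, yields exactly the constant (mu + 1/2)^(2 mu + 1) when s = 2 mu + 1.\<close>

lemma powr_times_exp_le:
  fixes x \<phi> s :: real
  assumes "0 \<le> x" "0 < \<phi>" "0 < s"
  shows "x powr s * exp (- (\<phi> * x)) \<le> (s/2) powr s * \<phi> powr (- s)"
proof -
  define y where "y = \<phi> * x / s"
  have "0 \<le> y"
    using assms by (simp add: y_def)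
  have "x = (s/2) * (2 * y) * (1/\<phi>)"
    using assms by (simp add: y_def)
  then have "x powr s = (s/2) powr s * (2 * y) powr s * (1/\<phi>) powr s"
    using assms \<open>0 \<le> y\<close> by (metis powr_mult)
  also have "(1/\<phi>) powr s = \<phi> powr (- s)"
    using assms by (simp add: powr_divide powr_minus field_simps)
  also have "(2 * y) powr s \<le> exp y powr s"
    using two_mult_le_exp[OF \<open>0 \<le> y\<close>] \<open>0 \<le> y\<close> assms by (intro powr_mono2) auto
  also have "exp y powr s = exp (\<phi> * x)"
    using assms by (simp add: powr_def y_def)
  finally have "x powr s \<le> (s/2) powr s * exp (\<phi> * x) * \<phi> powr (- s)"
    by (simp add: mult_left_mono mult_right_mono)
  then have "x powr s * exp (- (\<phi> * x)) \<le> (s/2) powr s * exp (\<phi> * x) * \<phi> powr (- s) * exp (- (\<phi> * x))"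
    by (rule mult_right_mono) simp
  also have "\<dots> = (s/2) powr s * \<phi> powr (- s) * (exp (\<phi> * x) * exp (- (\<phi> * x)))"
    by (simp only: mult_ac)
  finally show ?thesis
    by (simp add: exp_add[symmetric])
qed

text \<open>Mean value theorem for t^(1 - q); it replaces the comparison of a sum with an
  integral.\<close>

lemma powr_telescope_step:
  fixes t q :: real
  assumes "0 < t" "1 < q"
  shows "(q - 1) * (t + 1) powr (- q) \<le> t powr (1 - q) - (t + 1) powr (1 - q)"
proof -
  have "\<exists>z>t. z < t + 1 \<and> (t + 1) powr (1 - q) - t powr (1 - q)
      = (t + 1 - t) * ((1 - q) * z powr (1 - q - 1))"
    using assms by (intro MVT2 has_real_derivative_powr) auto
  then obtain z where z: "t < z" "z < t + 1"
    "(t + 1) powr (1 - q) - t powr (1 - q) = (1 - q) * z powr (- q)"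
    by auto
  have "(t + 1) powr (- q) \<le> z powr (- q)"
    using z assms by (intro powr_mono2') auto
  then have "(q - 1) * (t + 1) powr (- q) \<le> (q - 1) * z powr (- q)"
    using assms by (intro mult_left_mono) auto
  then show ?thesis
    using z(3) by (simp add: algebra_simps)
qed

text \<open>Each index up to the ceiling \<open>m\<close> of \<open>N\<close> contributes at most 1;
  beyond it the powers telescope to at most N/(q - 1). The bound is free of \<open>D\<close>, as the
  final constant requires.\<close>

lemma sum_min_powr_le:
  fixes N q :: real
  assumes N: "0 < N" and q: "1 < q"
  shows "(\<Sum>i\<in>{1..D}. min (N powr q * real i powr (- q)) 1) \<le> (N + 1) * (1 + 1/(q - 1))"
proof -
  define m where "m = nat \<lceil>N\<rceil>"
  have m: "N \<le> real m" "real m \<le> N + 1" "0 < m"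
    using N unfolding m_def by linarith+
  define S where "S = (\<lambda>D. \<Sum>i\<in>{1..D::nat}. min (N powr q * real i powr (- q)) 1)"
  have S_le: "S D \<le> real D" for D
    unfolding S_def by (rule order.trans[OF sum_mono[of _ _ "\<lambda>_. 1"]]) auto
  define K where "K = N powr q / (q - 1)"
  have "0 \<le> K"
    using q by (simp add: K_def)
  have tail: "S D \<le> real m + K * (real m powr (1 - q) - real D powr (1 - q))" if "m \<le> D" for D
    using that
  proof (induction D rule: dec_induct)
    case base
    then show ?case
      using S_le[of m] by simp
  next
    case (step D)
    have "S (Suc D) = S D + min (N powr q * real (Suc D) powr (- q)) 1"
      by (simp add: S_def)
    also have "min (N powr q * real (Suc D) powr (- q)) 1 \<le> K * ((q - 1) * (real D + 1) powr (- q))"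
      using q by (simp add: K_def add.commute)
    also have "\<dots> \<le> K * (real D powr (1 - q) - (real D + 1) powr (1 - q))"
      using powr_telescope_step[of "real D" q] q m step \<open>0 \<le> K\<close> by (intro mult_left_mono) auto
    finally show ?case
      using step.IH by (simp add: algebra_simps)
  qed
  have "S D \<le> real m + K * real m powr (1 - q)"
  proof (cases "m \<le> D")
    case True
    have "0 \<le> K * real D powr (1 - q)"
      using \<open>0 \<le> K\<close> by simp
    then show ?thesis
      using tail[OF True] by (simp add: algebra_simps)
  next
    case False
    have "0 \<le> K * real m powr (1 - q)"
      using \<open>0 \<le> K\<close> by simp
    then show ?thesis
      using S_le[of D] False by linarith
  qed
  also have "K * real m powr (1 - q) \<le> K * N powr (1 - q)"
    using m N q \<open>0 \<le> K\<close> by (intro mult_left_mono powr_mono2') auto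
  also have "K * N powr (1 - q) = N * (1/(q - 1))"
    using N by (simp add: K_def powr_add[symmetric])
  also have "\<dots> \<le> (N + 1) * (1/(q - 1))"
    using q by (intro mult_right_mono) auto
  finally show ?thesis
    using m(2) by (simp add: S_def algebra_simps)
qed

text \<open>No measurability of \<open>f\<close>, which spares us that of the oracle as a function of the noise.\<close>

lemma nn_integral_cmult_le:
  fixes c :: real
  assumes "0 < c"
  shows "(\<integral>\<^sup>+ x. ennreal c * f x \<partial>M) \<le> ennreal c * integral\<^sup>N M f"
proof -
  have cancel: "ennreal c * ennreal (1/c) = 1"
    using assms by (simp add: ennreal_mult[symmetric] ennreal_1[symmetric] del: ennreal_1)
  show ?thesis
    unfolding nn_integral_def[of M "\<lambda>x. ennreal c * f x"]
  proof (rule SUP_least, clarsimp)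
    fix g assume g: "simple_function M g" "g \<le> (\<lambda>x. ennreal c * f x)"
    have [measurable]: "g \<in> borel_measurable M"
      using g(1) by (rule borel_measurable_simple_function)
    have "ennreal (1/c) * g x \<le> f x" for x
    proof -
      have "ennreal (1/c) * g x \<le> ennreal (1/c) * (ennreal c * f x)"
        using g(2) by (intro mult_left_mono) (auto simp: le_fun_def)
      also have "\<dots> = (ennreal c * ennreal (1/c)) * f x"
        by (simp only: mult_ac)
      finally show ?thesis
        by (simp add: cancel)
    qed
    then have "ennreal (1/c) * integral\<^sup>N M g \<le> integral\<^sup>N M f"
      by (subst nn_integral_cmult[symmetric]) (auto intro: nn_integral_mono)
    then have "ennreal c * (ennreal (1/c) * integral\<^sup>N M g) \<le> ennreal c * integral\<^sup>N M f"
      by (intro mult_left_mono) auto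
    then show "integral\<^sup>S M g \<le> ennreal c * integral\<^sup>N M f"
      by (simp add: mult.assoc[symmetric] cancel nn_integral_eq_simple_integral[OF g(1)])
  qed
qed

section \<open>Linear forms of a standard Gaussian vector\<close>

abbreviation std_normal :: "real measure" where
  "std_normal \<equiv> density lborel (\<lambda>x. ennreal (std_normal_density x))"

lemma prob_space_std_gaussian: "prob_space (std_gaussian D)"
  unfolding std_gaussian_def by (intro prob_space_PiM prob_space_normal_density) simp

lemma distr_std_gaussian_component:
  "j < D \<Longrightarrow> distr (std_gaussian D) borel (\<lambda>z. z j) = std_normal"
proof -
  assume j: "j < D"
  have "distr (std_gaussian D) borel (\<lambda>z. z j) = distr (std_gaussian D) std_normal (\<lambda>z. z j)"
    by (intro distr_cong) auto
  also have "\<dots> = std_normal"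
    unfolding std_gaussian_def using j
    by (intro distr_PiM_component prob_space_normal_density) auto
  finally show ?thesis .
qed

lemma measurable_std_gaussian_component [measurable (raw)]:
  "j < D \<Longrightarrow> (\<lambda>z. z j) \<in> borel_measurable (std_gaussian D)"
proof -
  assume "j < D"
  then have "(\<lambda>z. z j) \<in> measurable (std_gaussian D) std_normal"
    unfolding std_gaussian_def by (intro measurable_component_singleton) auto
  then show ?thesis
    by simp
qed

lemma indep_vars_std_gaussian:
  assumes "0 < D"
  shows "prob_space.indep_vars (std_gaussian D) (\<lambda>_. borel) (\<lambda>j z. z j) {..<D}"
proof -
  interpret prob_space "std_gaussian D"
    by (rule prob_space_std_gaussian)
  have "distr (std_gaussian D) (\<Pi>\<^sub>M i\<in>{..<D}. borel) (\<lambda>z. \<lambda>j\<in>{..<D}. z j)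
      = distr (std_gaussian D) (std_gaussian D) (\<lambda>z. z)"
    by (rule distr_cong)
      (auto simp: std_gaussian_def space_PiM PiE_def extensional_def restrict_def fun_eq_iff
        intro!: sets_PiM_cong)
  also have "\<dots> = (\<Pi>\<^sub>M j\<in>{..<D}. distr (std_gaussian D) borel (\<lambda>z. z j))"
    unfolding distr_id by (subst std_gaussian_def) (intro PiM_cong refl, simp add: distr_std_gaussian_component)
  finally show ?thesis
    using assms by (subst indep_vars_iff_distr_eq_PiM') auto
qed

text \<open>Rotation invariance in one direction: a linear form with unit coefficient vector is
  again standard normal.\<close>

lemma std_gaussian_linear:
  assumes c: "(\<Sum>j<D. (c j)\<^sup>2) = (1::real)"
  shows "distributed (std_gaussian D) lborel (\<lambda>z. \<Sum>j<D. c j * z j) (\<lambda>x. ennreal (std_normal_density x))"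
proof -
  interpret prob_space "std_gaussian D"
    by (rule prob_space_std_gaussian)
  \<comment> \<open>Zero coefficients are discarded, since sums of independent normals are formed
    with positive standard deviations.\<close>
  define J where "J = {j\<in>{..<D}. c j \<noteq> 0}"
  have sumJ: "(\<Sum>j<D. h j) = (\<Sum>j\<in>J. h j)" if "\<And>j. c j = 0 \<Longrightarrow> h j = 0" for h :: "nat \<Rightarrow> real"
    unfolding J_def using that by (intro sum.mono_neutral_right) auto
  have "J \<noteq> {}"
    using c sumJ[of "\<lambda>j. (c j)\<^sup>2"] by auto
  then have "0 < D"
    by (auto simp: J_def)
  have "indep_vars (\<lambda>_. borel) (\<lambda>j z. z j) J"
    using indep_vars_std_gaussian[OF \<open>0 < D\<close>] by (rule indep_vars_subset) (auto simp: J_def)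
  then have ind: "indep_vars (\<lambda>_. borel) (\<lambda>j z. c j * z j) J"
    by (rule indep_vars_compose2[of _ _ _ "\<lambda>j x. c j * x"]) auto
  have dist: "distributed (std_gaussian D) lborel (\<lambda>z. c j * z j) (normal_density 0 \<bar>c j\<bar>)" if j: "j \<in> J" for j
  proof -
    have "distributed (std_gaussian D) lborel (\<lambda>z. z j) std_normal_density"
      unfolding distributed_def using j distr_std_gaussian_component[of j D]
      by (auto simp: J_def cong: distr_cong)
    from normal_density_affine[OF this, of "c j" 0] show ?thesis
      using j by (simp add: J_def)
  qed
  have "distributed (std_gaussian D) lborel (\<lambda>z. \<Sum>j\<in>J. c j * z j)
      (normal_density (\<Sum>j\<in>J. 0) (sqrt (\<Sum>j\<in>J. \<bar>c j\<bar>\<^sup>2)))"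
    using \<open>J \<noteq> {}\<close> ind dist by (intro sum_indep_normal) (auto simp: J_def)
  moreover have "(\<Sum>j\<in>J. \<bar>c j\<bar>\<^sup>2) = 1"
    using c sumJ[of "\<lambda>j. (c j)\<^sup>2"] by simp
  moreover have "(\<lambda>z. \<Sum>j\<in>J. c j * z j) = (\<lambda>z. \<Sum>j<D. c j * z j)"
    by (rule ext, rule sumJ[symmetric]) simp
  ultimately show ?thesis
    by simp
qed

lemma std_gaussian_second_moment:
  assumes "(\<Sum>j<D. (c j)\<^sup>2) = (1::real)"
  shows "(\<integral>\<^sup>+ z. ennreal ((\<Sum>j<D. c j * z j)\<^sup>2) \<partial>std_gaussian D) = 1"
proof -
  have "(\<integral>\<^sup>+ z. ennreal ((\<Sum>j<D. c j * z j)\<^sup>2) \<partial>std_gaussian D)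
      = (\<integral>\<^sup>+ x. ennreal (std_normal_density x) * ennreal (x\<^sup>2) \<partial>lborel)"
    by (rule distributed_nn_integral[OF std_gaussian_linear[OF assms], symmetric]) simp
  also have "\<dots> = (\<integral>\<^sup>+ x. ennreal (std_normal_density x * x\<^sup>2) \<partial>lborel)"
    by (simp add: ennreal_mult')
  also have "\<dots> = ennreal 1"
    using std_normal_moment_even[of 1] by (intro nn_integral_eq_integrable[THEN iffD2] conjI)
      (auto simp: has_bochner_integral_iff eval_nat_numeral)
  finally show ?thesis
    by simp
qed

lemma std_gaussian_AE_linear_neq:
  assumes "(\<Sum>j<D. (c j)\<^sup>2) = (1::real)"
  shows "AE z in std_gaussian D. (\<Sum>j<D. c j * z j) \<noteq> b"
proof -
  interpret prob_space "std_gaussian D"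
    by (rule prob_space_std_gaussian)
  have "AE x in lborel. x \<noteq> b"
    by (rule AE_lborel_singleton)
  then show ?thesis
    by (subst distributed_AE2[OF std_gaussian_linear[OF assms], of "\<lambda>x. x \<noteq> b"]) auto
qed

section \<open>Conjugate gradients for one realisation of the noise\<close>

declare One_nat_def [simp del]

lemma continuous_on_unit_pieces:
  fixes h :: "real \<Rightarrow> 'b::topological_space"
  assumes "\<And>k. k < n \<Longrightarrow> continuous_on {real k..real (Suc k)} h"
  shows "continuous_on {0..real n} h"
  using assms
proof (induction n)
  case (Suc n)
  have "{0..real (Suc n)} = {0..real n} \<union> {real n..real (Suc n)}"
    by auto
  moreover have "continuous_on {0..real n} h" "continuous_on {real n..real (Suc n)} h"
    using Suc by auto
  ultimately show ?case
    by (simp only: continuous_on_closed_Un closed_atLeastAtMost)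
qed simp

text \<open>One fixed noise vector, without probability. Nondegeneracy makes the minimisers unique
  up to index \<open>d\<close>; for Gaussian noise it holds almost surely by
  \<open>AE_nondegenerate\<close>.\<close>

locale cg_realisation =
  fixes D P :: nat and A :: "real mat" and lam :: "nat \<Rightarrow> real" and u v :: "nat \<Rightarrow> real vec"
    and f xi :: "real vec"
  assumes model: "model D P A lam u v"
    and f: "f \<in> carrier_vec P" and xi: "xi \<in> carrier_vec D"
    and nondeg: "nondegenerate D lam u (observation A f xi)"
begin

abbreviation Y where "Y \<equiv> observation A f xi"
abbreviation y where "y i \<equiv> scalar_prod Y (u i)"
abbreviation g where "g i \<equiv> scalar_prod (A *\<^sub>v f) (u i)"
abbreviation e where "e i \<equiv> scalar_prod xi (u i)"
abbreviation res where "res \<equiv> cg_res_interp D lam u Y"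
abbreviation tr where "tr \<equiv> cg_res_trunc D lam u Y"
abbreviation slope where "slope \<equiv> cg_slope D lam u Y"
abbreviation d where "d \<equiv> num_distinct D lam"

section \<open>Coordinates in the singular bases\<close>

lemma A: "A \<in> carrier_mat D P"
  and lam_pos: "i \<in> {1..D} \<Longrightarrow> 0 < lam i"
  and u: "orthonormal_family D D u" and v: "orthonormal_family P D v"
  and AT_u: "i \<in> {1..D} \<Longrightarrow> transpose_mat A *\<^sub>v u i = lam i \<cdot>\<^sub>v v i"
  using model by (auto simp: model_def singular_system_def)

lemma u_carrier: "i \<in> {1..D} \<Longrightarrow> u i \<in> carrier_vec D"
  and v_carrier: "i \<in> {1..D} \<Longrightarrow> v i \<in> carrier_vec P"
  using u v by (auto simp: orthonormal_family_def)

lemma Af_carrier: "A *\<^sub>v f \<in> carrier_vec D"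
  using A f by simp

lemma Y_carrier: "Y \<in> carrier_vec D"
  using Af_carrier xi by (simp add: observation_def)

lemma y_eq: "i \<in> {1..D} \<Longrightarrow> y i = g i + e i"
  unfolding observation_def using Af_carrier xi u_carrier by (intro add_scalar_prod_distrib) auto

lemma g_eq:
  assumes "i \<in> {1..D}"
  shows "g i = lam i * scalar_prod f (v i)"
proof -
  have "g i = scalar_prod (u i) (A *\<^sub>v f)"
    using comm_scalar_prod[OF Af_carrier u_carrier[OF assms]] .
  also have "\<dots> = scalar_prod (lam i \<cdot>\<^sub>v v i) f"
    using transpose_vec_mult_scalar[OF A f u_carrier[OF assms]] AT_u[OF assms] by simp
  also have "\<dots> = lam i * scalar_prod f (v i)"
    using v_carrier[OF assms] f by (simp add: comm_scalar_prod[of f P])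
  finally show ?thesis .
qed

text \<open>The spectral measure of the observation: the squared norm of a polynomial in A A^T
  applied to \<open>Y\<close> becomes \<open>pts.ip p p\<close>.\<close>

sublocale pts: weighted_points "{1..D}" "\<lambda>i. (lam i)\<^sup>2" "\<lambda>i. (y i)\<^sup>2"
  using lam_pos by unfold_locales (auto simp: less_imp_neq[symmetric])

lemma equal_singular_value:
  assumes "i \<in> {1..D}"
  obtains j where "j \<in> {1..D}" "lam j = lam i" "(y j)\<^sup>2 \<noteq> 0"
proof -
  have "(\<Sum>j\<in>{j\<in>{1..D}. lam j = lam i}. (y j)\<^sup>2) > 0"
    using nondeg assms unfolding nondegenerate_def by blast
  then have "\<not> (\<forall>j\<in>{j\<in>{1..D}. lam j = lam i}. (y j)\<^sup>2 = 0)"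
    using sum.neutral by fastforce
  then show ?thesis
    using that by blast
qed

text \<open>Nondegeneracy puts mass on every distinct singular value, and squaring is injective on
  positive numbers.\<close>

lemma pts_d: "pts.d = d"
proof -
  have "(\<lambda>i. (lam i)\<^sup>2) ` {i\<in>{1..D}. (y i)\<^sup>2 \<noteq> 0} = (\<lambda>s. s\<^sup>2) ` (lam ` {1..D})"
  proof (intro antisym subsetI)
    fix s assume "s \<in> (\<lambda>s. s\<^sup>2) ` (lam ` {1..D})"
    then obtain i where i: "i \<in> {1..D}" "s = (lam i)\<^sup>2"
      by blast
    obtain j where "j \<in> {1..D}" "lam j = lam i" "(y j)\<^sup>2 \<noteq> 0"
      using equal_singular_value[OF i(1)] .
    then show "s \<in> (\<lambda>i. (lam i)\<^sup>2) ` {i\<in>{1..D}. (y i)\<^sup>2 \<noteq> 0}"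
      using i(2) by (intro image_eqI[of _ _ j]) auto
  qed auto
  moreover have "inj_on (\<lambda>s. s\<^sup>2) (lam ` {1..D})"
  proof (rule inj_onI)
    fix s s' assume "s \<in> lam ` {1..D}" "s' \<in> lam ` {1..D}" "s\<^sup>2 = s'\<^sup>2"
    then show "s = s'"
      using lam_pos by (auto simp: power2_eq_iff_nonneg less_imp_le)
  qed
  ultimately show ?thesis
    unfolding pts.d_def num_distinct_def by (simp only: card_image)
qed

section \<open>The interpolated residual polynomials of the data\<close>

lemma sq_norm2_fcalc_poly: "sq_norm2 (fcalc D lam u (poly p) Y) = pts.ip p p"
  unfolding sq_norm2_fcalc[OF u] pts.ip_def by (simp add: power2_eq_square mult_ac)

lemma is_res_cg_res:
  assumes "k \<le> d"
  shows "pts.is_res k (cg_res D lam u Y k)"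
proof -
  have iff: "cg_minimiser D lam u Y k p \<longleftrightarrow> pts.is_res k p" for p
    unfolding cg_minimiser_def sq_norm2_fcalc_poly
    using assms by (intro pts.minimiser_iff_is_res) (simp add: pts_d)
  obtain p where "pts.is_res k p"
    using pts.is_res_exists[of k] assms pts_d by auto
  then have "\<exists>!p. pts.is_res k p"
    using pts.is_res_unique[of k] assms pts_d by auto
  then show ?thesis
    unfolding cg_res_def iff by (rule theI')
qed

text \<open>At a positive integer \<open>t\<close> the definition uses the piece that ends there,
  with weight 1. The piece that starts there gives the same polynomial with weight 0, so the formula
  holds on the closed interval and pieces can be glued.\<close>

lemma res_on_piece:
  assumes "real k \<le> t" "t \<le> real (Suc k)"
  shows "res t = Polynomial.smult (1 - (t - real k)) (cg_res D lam u Y k)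
    + Polynomial.smult (t - real k) (cg_res D lam u Y (Suc k))"
proof (cases "t = real k")
  case True
  show ?thesis
  proof (cases k)
    case (Suc m)
    have "\<lceil>t\<rceil> = int m + 1"
      using True Suc by (intro ceiling_unique) auto
    then have "nat (\<lceil>t\<rceil> - 1) = m"
      by simp
    then show ?thesis
      using True Suc by (simp add: cg_res_interp_def Let_def One_nat_def)
  qed (use True in \<open>simp add: cg_res_interp_def\<close>)
next
  case False
  then have "\<lceil>t\<rceil> = int k + 1"
    using assms by (intro ceiling_unique) auto
  then show ?thesis
    using False assms by (simp add: cg_res_interp_def Let_def One_nat_def)
qed

lemma piece_exists:
  assumes "0 < t" "t \<le> real d"
  obtains k where "k < d" "real k < t" "t \<le> real (Suc k)"
proof -
  define k where "k = nat (\<lceil>t\<rceil> - 1)"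
  have "real k < t" "t \<le> real (Suc k)"
    using assms(1) unfolding k_def by linarith+
  then show ?thesis
    using that[of k] assms(2) by linarith
qed

lemma quasi_res_res:
  assumes "0 < t" "t \<le> real d"
  obtains k where "k < pts.d" "pts.quasi_res k (res t)"
proof -
  obtain k where k: "k < d" "real k < t" "t \<le> real (Suc k)"
    using piece_exists[OF assms] .
  have "pts.quasi_res k (res t)"
    unfolding res_on_piece[OF less_imp_le[OF k(2)] k(3)]
    using k is_res_cg_res by (intro pts.quasi_res_interp) (auto simp: pts_d)
  then show ?thesis
    using that k pts_d by simp
qed

lemma res_rprod:
  assumes "0 < t" "t \<le> real d"
  obtains xs where "xs \<noteq> []" "\<forall>a\<in>set xs. 0 < a" "res t = rprod xs"
proof -
  obtain k where k: "k < pts.d" "pts.quasi_res k (res t)"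
    using quasi_res_res[OF assms] .
  obtain xs where "length xs = Suc k" "\<forall>a\<in>set xs. 0 < a" "res t = rprod xs"
    using pts.quasi_res_rprod[OF k(2,1)] .
  then show ?thesis
    using that[of xs] by (cases xs) auto
qed

lemma res_0: "res 0 = 1"
proof -
  have "pts.is_res 0 (res 0)"
    using is_res_cg_res[of 0] by (simp add: cg_res_interp_def)
  then have "degree (res 0) = 0" "poly (res 0) 0 = 1"
    by (auto simp: pts.is_res_def)
  then show ?thesis
    by (metis degree_eq_zeroE poly_pCons mult_zero_left add.right_neutral one_pCons)
qed

lemma slope_0: "slope 0 = 0"
  by (simp add: cg_slope_def res_0)

lemma tr_0: "tr 0 x = 1"
  by (simp add: cg_res_trunc_def)

lemma tr_eq_trunc: "t \<noteq> 0 \<Longrightarrow> tr t x = trunc (res t) x"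
  by (simp add: cg_res_trunc_def trunc_def first_zero_def)

lemma slope_rprod:
  assumes "\<forall>a\<in>set xs. 0 < a" "res t = rprod xs"
  shows "slope t = (\<Sum>a\<leftarrow>xs. 1/a)"
proof -
  have "0 \<le> (\<Sum>a\<leftarrow>xs. 1/a)"
    using assms(1) by (intro sum_list_nonneg) auto
  then show ?thesis
    by (simp add: cg_slope_def assms(2) poly_pderiv_rprod_0)
qed

lemma slope_pos:
  assumes "0 < t" "t \<le> real d"
  shows "0 < slope t"
proof -
  obtain xs where xs: "xs \<noteq> []" "\<forall>a\<in>set xs. 0 < a" "res t = rprod xs"
    using res_rprod[OF assms] .
  then have "1 / hd xs \<le> (\<Sum>a\<leftarrow>xs. 1/a)"
    by (intro member_le_sum_list) auto
  moreover have "0 < 1 / hd xs"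
    using xs by simp
  ultimately show ?thesis
    using slope_rprod[OF xs(2,3)] by linarith
qed

lemma tr_bounds:
  assumes "0 \<le> t" "t \<le> real d" "0 \<le> x"
  shows "0 \<le> tr t x" "tr t x \<le> 1" "tr t x \<le> exp (- (slope t * x))" "1 - tr t x \<le> min (slope t * x) 1"
proof -
  have "0 \<le> tr t x \<and> tr t x \<le> 1 \<and> tr t x \<le> exp (- (slope t * x)) \<and> 1 - tr t x \<le> min (slope t * x) 1"
  proof (cases "t = 0")
    case False
    then obtain xs where xs: "xs \<noteq> []" "\<forall>a\<in>set xs. 0 < a" "res t = rprod xs"
      using res_rprod[of t] assms by auto
    show ?thesis
      unfolding tr_eq_trunc[OF False] slope_rprod[OF xs(2,3)] unfolding xs(3)
      using trunc_bounds[OF xs(2,1) assms(3)] by blast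
  qed (simp add: tr_0 slope_0)
  then show "0 \<le> tr t x" "tr t x \<le> 1" "tr t x \<le> exp (- (slope t * x))" "1 - tr t x \<le> min (slope t * x) 1"
    by auto
qed

lemma tr_cases: "tr t x = poly (res t) x \<or> tr t x = 0"
  by (cases "t = 0") (auto simp: tr_0 res_0 tr_eq_trunc trunc_def)

section \<open>Continuity in t\<close>

lemma tr_eq_Inf:
  assumes "0 \<le> t" "t \<le> real d" "0 \<le> x"
  shows "tr t x = max 0 (INF y\<in>{0..x}. poly (res t) y)"
proof (cases "t = 0")
  case True
  then show ?thesis
    using assms(3) by (simp add: tr_0 res_0)
next
  case False
  then obtain xs where xs: "xs \<noteq> []" "\<forall>a\<in>set xs. 0 < a" "res t = rprod xs"
    using res_rprod[of t] assms by auto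
  show ?thesis
    unfolding tr_eq_trunc[OF False] unfolding xs(3) using xs assms by (intro trunc_eq_Inf)
qed

text \<open>The infimum formula reduces this to \<open>continuous_on_Inf_interp\<close> on each unit
  interval. It covers t = 0 as well, although the first zero moves to infinity there.\<close>

lemma continuous_on_tr:
  assumes "0 \<le> x"
  shows "continuous_on {0..real d} (\<lambda>t. tr t x)"
proof (rule continuous_on_unit_pieces)
  fix k assume k: "k < d"
  let ?h = "\<lambda>\<alpha>. INF y\<in>{0..x}. poly (Polynomial.smult (1 - \<alpha>) (cg_res D lam u Y k)
    + Polynomial.smult \<alpha> (cg_res D lam u Y (Suc k))) y"
  have "continuous_on {real k..real (Suc k)} (\<lambda>t. max 0 (?h (t - real k)))"
    by (intro continuous_on_max continuous_on_const
        continuous_on_compose2[OF continuous_on_Inf_interp[OF assms]] continuous_intros) auto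
  moreover have "max 0 (?h (t - real k)) = tr t x" if "t \<in> {real k..real (Suc k)}" for t
  proof -
    have "real k \<le> t" "t \<le> real (Suc k)" "0 \<le> t" "t \<le> real d"
      using that k by auto
    then show ?thesis
      using tr_eq_Inf[of t x] assms by (simp add: res_on_piece)
  qed
  ultimately show "continuous_on {real k..real (Suc k)} (\<lambda>t. tr t x)"
    by (rule continuous_on_eq)
qed

lemma continuous_on_res: "continuous_on {0..real d} (\<lambda>t. poly (res t) x)"
proof (rule continuous_on_unit_pieces)
  fix k assume k: "k < d"
  have "continuous_on {real k..real (Suc k)} (\<lambda>t. (1 - (t - real k)) * poly (cg_res D lam u Y k) x
      + (t - real k) * poly (cg_res D lam u Y (Suc k)) x)"
    by (intro continuous_intros)
  then show "continuous_on {real k..real (Suc k)} (\<lambda>t. poly (res t) x)"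
    by (rule continuous_on_eq) (auto simp: res_on_piece)
qed

section \<open>Loss and error terms in spectral coordinates\<close>

lemma stoch_err_eq:
  assumes "0 \<le> t" "t \<le> real d"
  shows "stoch_err D A lam u f xi t = (\<Sum>i\<in>{1..D}. (1 - tr t ((lam i)\<^sup>2)) * (e i)\<^sup>2)"
  unfolding stoch_err_def sq_norm2_fcalc[OF u]
  by (intro sum.cong refl) (simp add: power_mult_distrib tr_bounds[OF assms])

lemma A_est: "A *\<^sub>v cg_est D A lam u Y t = Y - fcalc D lam u (poly (res t)) Y"
  unfolding cg_est_def by (rule mult_pinv_vec[OF model]) (simp add: Y_carrier)

lemma residual_component:
  assumes "i \<in> {1..D}"
  shows "scalar_prod (Y - fcalc D lam u (poly (res t)) Y) (u i) = (1 - poly (res t) ((lam i)\<^sup>2)) * y i"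
  unfolding minus_scalar_prod_distrib[OF Y_carrier fcalc_carrier u_carrier[OF assms]]
    fcalc_component[OF u assms] by (simp add: algebra_simps)

lemma resid_sq_eq: "resid_sq D A lam u Y t = (\<Sum>i\<in>{1..D}. (poly (res t) ((lam i)\<^sup>2) * y i)\<^sup>2)"
proof -
  have c: "Y - fcalc D lam u (poly (res t)) Y - Y \<in> carrier_vec D"
    using Y_carrier by simp
  show ?thesis
    unfolding resid_sq_def A_est sq_norm2_parseval[OF u c]
  proof (intro sum.cong refl)
    fix i assume i: "i \<in> {1..D}"
    have "scalar_prod (Y - fcalc D lam u (poly (res t)) Y - Y) (u i)
        = (1 - poly (res t) ((lam i)\<^sup>2)) * y i - y i"
      unfolding residual_component[OF i, symmetric]
      using Y_carrier u_carrier[OF i] by (intro minus_scalar_prod_distrib) auto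
    then show "(scalar_prod (Y - fcalc D lam u (poly (res t)) Y - Y) (u i))\<^sup>2
        = (poly (res t) ((lam i)\<^sup>2) * y i)\<^sup>2"
      by (simp add: algebra_simps)
  qed
qed

lemma approx_err_eq:
  assumes "0 \<le> t" "t \<le> real d"
  shows "approx_err D A lam u f xi t = (\<Sum>i\<in>{1..D}. tr t ((lam i)\<^sup>2) * (g i)\<^sup>2)
    + (\<Sum>i\<in>{1..D}. (poly (res t) ((lam i)\<^sup>2) * y i)\<^sup>2) - (\<Sum>i\<in>{1..D}. tr t ((lam i)\<^sup>2) * (y i)\<^sup>2)"
proof -
  have "sq_norm2 (fcalc D lam u (\<lambda>x. sqrt (tr t x)) w)
      = (\<Sum>i\<in>{1..D}. tr t ((lam i)\<^sup>2) * (scalar_prod w (u i))\<^sup>2)" for w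
    unfolding sq_norm2_fcalc[OF u]
    by (intro sum.cong refl) (simp add: power_mult_distrib tr_bounds[OF assms])
  then show ?thesis
    unfolding approx_err_def Let_def resid_sq_eq by simp
qed

lemma pred_loss_eq:
  "pred_loss D A lam u f xi t = (\<Sum>i\<in>{1..D}. ((1 - poly (res t) ((lam i)\<^sup>2)) * y i - g i)\<^sup>2)"
proof -
  have est: "cg_est D A lam u Y t \<in> carrier_vec P"
    unfolding cg_est_def using pinv_carrier[OF A] by (intro carrier_vecI) simp
  have eq: "A *\<^sub>v (cg_est D A lam u Y t - f) = (Y - fcalc D lam u (poly (res t)) Y) - A *\<^sub>v f"
    using mult_minus_distrib_mat_vec[OF A est f] by (simp add: A_est)
  have c: "Y - fcalc D lam u (poly (res t)) Y \<in> carrier_vec D"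
    using Y_carrier by simp
  then have c': "Y - fcalc D lam u (poly (res t)) Y - A *\<^sub>v f \<in> carrier_vec D"
    using Af_carrier by simp
  show ?thesis
    unfolding pred_loss_def eq sq_norm2_parseval[OF u c']
    by (intro sum.cong refl)
      (simp add: minus_scalar_prod_distrib[OF c Af_carrier u_carrier] residual_component)
qed

text \<open>Coordinate by coordinate. Where the truncation equals the polynomial, the two error
  terms add up to the squared loss exactly; where it is 0, the loss is (b - c)^2 with c the residual
  coordinate, and (b - c)^2 \<le> 2 (b^2 + c^2).\<close>

lemma pred_loss_le:
  assumes "0 \<le> t" "t \<le> real d"
  shows "pred_loss D A lam u f xi t \<le> 2 * (approx_err D A lam u f xi t + stoch_err D A lam u f xi t)"
proof -
  have "pred_loss D A lam u f xi t \<le> (\<Sum>i\<in>{1..D}. 2 * (tr t ((lam i)\<^sup>2) * (g i)\<^sup>2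
      + (poly (res t) ((lam i)\<^sup>2) * y i)\<^sup>2 - tr t ((lam i)\<^sup>2) * (y i)\<^sup>2
      + (1 - tr t ((lam i)\<^sup>2)) * (e i)\<^sup>2))"
    unfolding pred_loss_eq
  proof (rule sum_mono)
    fix i assume i: "i \<in> {1..D}"
    define a b q s where "a = g i" and "b = e i" and "q = poly (res t) ((lam i)\<^sup>2)" and "s = tr t ((lam i)\<^sup>2)"
    have "((1 - q) * (a + b) - a)\<^sup>2
        \<le> 2 * (s * a\<^sup>2 + (q * (a + b))\<^sup>2 - s * (a + b)\<^sup>2 + (1 - s) * b\<^sup>2)"
    proof (cases "s = 0")
      case True
      define c where "c = q * (a + b)"
      have "((1 - q) * (a + b) - a)\<^sup>2 = (b - c)\<^sup>2"
        unfolding c_def by (simp add: algebra_simps)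
      also have "\<dots> = 2 * (c\<^sup>2 + b\<^sup>2) - (b + c)\<^sup>2"
        by (simp add: power2_eq_square algebra_simps)
      also have "\<dots> \<le> 2 * (c\<^sup>2 + b\<^sup>2)"
        by simp
      finally show ?thesis
        unfolding True c_def by simp
    next
      case False
      then have "s = q"
        using tr_cases unfolding q_def s_def by blast
      have "s * a\<^sup>2 + (q * (a + b))\<^sup>2 - s * (a + b)\<^sup>2 + (1 - s) * b\<^sup>2 = ((1 - q) * (a + b) - a)\<^sup>2"
        unfolding \<open>s = q\<close> by (simp add: power2_eq_square algebra_simps)
      then show ?thesis
        by simp
    qed
    then show "((1 - poly (res t) ((lam i)\<^sup>2)) * y i - g i)\<^sup>2
        \<le> 2 * (tr t ((lam i)\<^sup>2) * (g i)\<^sup>2 + (poly (res t) ((lam i)\<^sup>2) * y i)\<^sup>2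
          - tr t ((lam i)\<^sup>2) * (y i)\<^sup>2 + (1 - tr t ((lam i)\<^sup>2)) * (e i)\<^sup>2)"
      unfolding y_eq[OF i] a_def b_def q_def s_def .
  qed
  also have "\<dots> = 2 * (approx_err D A lam u f xi t + stoch_err D A lam u f xi t)"
    unfolding approx_err_eq[OF assms] stoch_err_eq[OF assms]
    by (simp add: sum_distrib_left[symmetric] sum.distrib sum_subtractf)
  finally show ?thesis .
qed

text \<open>By \<open>pts.ip_self_le_trunc\<close> the squared residual is absorbed by the
  subtracted term, leaving only the filtered signal.\<close>

lemma approx_err_le:
  assumes "0 < t" "t \<le> real d"
  shows "approx_err D A lam u f xi t \<le> (\<Sum>i\<in>{1..D}. tr t ((lam i)\<^sup>2) * (g i)\<^sup>2)"
proof -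
  obtain k where k: "k < pts.d" "pts.quasi_res k (res t)"
    using quasi_res_res[OF assms] .
  have "(\<Sum>i\<in>{1..D}. (poly (res t) ((lam i)\<^sup>2) * y i)\<^sup>2) = pts.ip (res t) (res t)"
    unfolding pts.ip_def by (simp add: power2_eq_square mult_ac)
  also have "\<dots> \<le> (\<Sum>i\<in>{1..D}. tr t ((lam i)\<^sup>2) * (y i)\<^sup>2)"
    using pts.ip_self_le_trunc[OF k(2,1)] assms(1) by (simp add: tr_eq_trunc mult.commute)
  finally show ?thesis
    using assms by (simp add: approx_err_eq)
qed

text \<open>With s = 2 mu + 1 the squared signal coordinate is x^s times the summand
  \<open>c i\<close> of the source norm, because 2 s - 4 mu = 2. The exponential bound on the
  truncation then reduces the claim to \<open>powr_times_exp_le\<close>.\<close>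

lemma bias_le:
  assumes t: "0 < t" "t \<le> real d" and mu: "0 < mu" and R: "source_norm D lam v mu f \<le> R"
  shows "approx_err D A lam u f xi t
    \<le> R\<^sup>2 * (mu + 1/2) powr (2 * mu + 1) * slope t powr (- (2 * mu + 1))"
proof -
  define s where "s = 2 * mu + 1"
  define K where "K = (s/2) powr s * slope t powr (- s)"
  define c where "c i = lam i powr (- 4 * mu) * (scalar_prod f (v i))\<^sup>2" for i
  have c_nonneg: "0 \<le> c i" for i
    by (simp add: c_def)
  have "approx_err D A lam u f xi t \<le> (\<Sum>i\<in>{1..D}. tr t ((lam i)\<^sup>2) * (g i)\<^sup>2)"
    using approx_err_le[OF t] .
  also have "\<dots> \<le> (\<Sum>i\<in>{1..D}. K * c i)"
  proof (rule sum_mono)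
    fix i assume i: "i \<in> {1..D}"
    have sq: "(lam i)\<^sup>2 = lam i powr 2"
      using lam_pos[OF i] by simp
    have "((lam i)\<^sup>2) powr s * lam i powr (- 4 * mu) = lam i powr (2 * s + - 4 * mu)"
      unfolding sq powr_powr powr_add ..
    also have "2 * s + - 4 * mu = 2"
      by (simp add: s_def)
    finally have "((lam i)\<^sup>2) powr s * lam i powr (- 4 * mu) = (lam i)\<^sup>2"
      unfolding sq .
    then have gi: "(g i)\<^sup>2 = ((lam i)\<^sup>2) powr s * c i"
      unfolding g_eq[OF i] c_def by (simp add: power_mult_distrib mult.assoc[symmetric])
    have "tr t ((lam i)\<^sup>2) * ((lam i)\<^sup>2) powr s
        \<le> exp (- (slope t * (lam i)\<^sup>2)) * ((lam i)\<^sup>2) powr s"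
      using tr_bounds(3)[of t "(lam i)\<^sup>2"] t by (intro mult_right_mono) auto
    also have "\<dots> \<le> K"
      unfolding K_def using powr_times_exp_le[of "(lam i)\<^sup>2" "slope t" s] slope_pos[OF t] mu
      by (simp add: s_def mult.commute)
    finally show "tr t ((lam i)\<^sup>2) * (g i)\<^sup>2 \<le> K * c i"
      unfolding gi mult.assoc[symmetric] by (rule mult_right_mono) (rule c_nonneg)
  qed
  also have "\<dots> = K * (\<Sum>i\<in>{1..D}. c i)"
    by (simp add: sum_distrib_left)
  also have "\<dots> \<le> K * R\<^sup>2"
  proof (rule mult_left_mono)
    show "(\<Sum>i\<in>{1..D}. c i) \<le> R\<^sup>2"
      unfolding c_def using R unfolding source_norm_def by (rule sqrt_le_D)
  qed (simp add: K_def)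
  also have "\<dots> = R\<^sup>2 * (mu + 1/2) powr (2 * mu + 1) * slope t powr (- (2 * mu + 1))"
    by (simp add: K_def s_def add_divide_distrib)
  finally show ?thesis .
qed

lemma stoch_err_le:
  assumes "0 \<le> t" "t \<le> real d"
  shows "stoch_err D A lam u f xi t \<le> (\<Sum>i\<in>{1..D}. min (slope t * (lam i)\<^sup>2) 1 * (e i)\<^sup>2)"
  unfolding stoch_err_eq[OF assms]
  by (intro sum_mono mult_right_mono tr_bounds(4)[OF assms]) auto

lemma loss_bound:
  assumes t: "0 < t" "t \<le> real d" and mu: "0 < mu" and R: "source_norm D lam v mu f \<le> R"
  shows "pred_loss D A lam u f xi t
    \<le> 2 * R\<^sup>2 * (mu + 1/2) powr (2 * mu + 1) * slope t powr (- 2 * mu - 1)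
      + 2 * sq_norm2 (fcalc D lam u (\<lambda>x. min (sqrt (slope t * x)) 1) xi)"
proof -
  have sq: "(min (sqrt z) 1)\<^sup>2 = min z 1" if "0 \<le> z" for z :: real
    using that by (auto simp: min_def)
  have V: "sq_norm2 (fcalc D lam u (\<lambda>x. min (sqrt (slope t * x)) 1) xi)
      = (\<Sum>i\<in>{1..D}. min (slope t * (lam i)\<^sup>2) 1 * (e i)\<^sup>2)"
    unfolding sq_norm2_fcalc[OF u] power_mult_distrib
    using slope_pos[OF t] by (intro sum.cong refl) (simp only: sq mult_nonneg_nonneg less_imp_le zero_le_power2)
  have eq: "- 2 * mu - 1 = - (2 * mu + 1)"
    by simp
  have "pred_loss D A lam u f xi t \<le> 2 * (approx_err D A lam u f xi t + stoch_err D A lam u f xi t)"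
    using t by (intro pred_loss_le) auto
  also have "\<dots> \<le> 2 * (R\<^sup>2 * (mu + 1/2) powr (2 * mu + 1) * slope t powr (- (2 * mu + 1))
      + (\<Sum>i\<in>{1..D}. min (slope t * (lam i)\<^sup>2) 1 * (e i)\<^sup>2))"
    using t by (intro mult_left_mono add_mono bias_le[OF assms] stoch_err_le) auto
  finally show ?thesis
    unfolding V eq by (simp only: distrib_left mult.assoc)
qed

section \<open>The balanced oracle\<close>

lemma stoch_err_nonneg:
  assumes "0 \<le> t" "t \<le> real d"
  shows "0 \<le> stoch_err D A lam u f xi t"
  unfolding stoch_err_eq[OF assms] using tr_bounds(2)[OF assms] by (intro sum_nonneg) auto

text \<open>The final residual polynomial vanishes at every node: a node whose own weight is zero
  coincides with one that carries mass. Hence the set defining the oracle contains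
  \<open>d\<close>.\<close>

lemma approx_err_d: "approx_err D A lam u f xi (real d) = 0"
proof -
  have zero: "poly (res (real d)) ((lam i)\<^sup>2) = 0" if i: "i \<in> {1..D}" for i
  proof -
    obtain j where j: "j \<in> {1..D}" "lam j = lam i" "(y j)\<^sup>2 \<noteq> 0"
      using equal_singular_value[OF i] .
    have "pts.is_res pts.d (res (real d))"
      using is_res_cg_res[of d] by (simp add: pts_d res_on_piece[of d])
    from pts.is_res_d_vanishes[OF this j(1,3)] show ?thesis
      using j(2) by simp
  qed
  moreover have "tr (real d) ((lam i)\<^sup>2) = 0" if i: "i \<in> {1..D}" for i
    using tr_cases[of "real d" "(lam i)\<^sup>2"] zero[OF i] by simp
  ultimately show ?thesis
    by (simp add: approx_err_eq)
qed

lemma continuous_on_errors: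
  "continuous_on {0..real d} (stoch_err D A lam u f xi)"
  "continuous_on {0..real d} (approx_err D A lam u f xi)"
proof -
  have "continuous_on {0..real d} (\<lambda>t. \<Sum>i\<in>{1..D}. (1 - tr t ((lam i)\<^sup>2)) * (e i)\<^sup>2)"
    by (intro continuous_intros continuous_on_tr) auto
  then show "continuous_on {0..real d} (stoch_err D A lam u f xi)"
    by (rule continuous_on_eq) (simp add: stoch_err_eq)
  have "continuous_on {0..real d} (\<lambda>t. (\<Sum>i\<in>{1..D}. tr t ((lam i)\<^sup>2) * (g i)\<^sup>2)
    + (\<Sum>i\<in>{1..D}. (poly (res t) ((lam i)\<^sup>2) * y i)\<^sup>2) - (\<Sum>i\<in>{1..D}. tr t ((lam i)\<^sup>2) * (y i)\<^sup>2))"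
    by (intro continuous_intros continuous_on_tr continuous_on_res) auto
  then show "continuous_on {0..real d} (approx_err D A lam u f xi)"
    by (rule continuous_on_eq) (simp add: approx_err_eq)
qed

abbreviation tau where "tau \<equiv> balanced_oracle D A lam u f xi"

text \<open>The defining set is closed by continuity and contains \<open>d\<close>, so its infimum
  is attained. If the oracle is positive, the reverse inequality holds at all earlier times and
  passes to the limit, which gives equality of the two errors.\<close>

lemma balanced_oracle:
  shows "0 \<le> tau" "tau \<le> real d"
    and "approx_err D A lam u f xi tau \<le> stoch_err D A lam u f xi tau"
    and "0 < tau \<Longrightarrow> stoch_err D A lam u f xi tau \<le> approx_err D A lam u f xi tau"
proof -
  define T where "T = {t\<in>{0..real d}. approx_err D A lam u f xi t \<le> stoch_err D A lam u f xi t}"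
  have tau: "tau = Inf T"
    unfolding balanced_oracle_def T_def by (rule arg_cong[of _ _ Inf]) auto
  have "real d \<in> T"
    using approx_err_d stoch_err_nonneg[of "real d"] by (simp add: T_def)
  moreover have "closed T"
    unfolding T_def by (intro continuous_on_closed_Collect_le continuous_on_errors) auto
  moreover have bdd: "bdd_below T"
    by (rule bdd_belowI[of _ 0]) (auto simp: T_def)
  ultimately have "tau \<in> T"
    unfolding tau by (intro closed_contains_Inf) auto
  then show *: "0 \<le> tau" "tau \<le> real d" "approx_err D A lam u f xi tau \<le> stoch_err D A lam u f xi tau"
    by (auto simp: T_def)
  assume "0 < tau"
  let ?S = "{t\<in>{0..tau}. stoch_err D A lam u f xi t \<le> approx_err D A lam u f xi t}"
  have "closed ?S"
    by (intro continuous_on_closed_Collect_le continuous_on_subset[OF continuous_on_errors(1)]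
        continuous_on_subset[OF continuous_on_errors(2)]) (use * in auto)
  moreover have "{0..<tau} \<subseteq> ?S"
  proof
    fix t assume t: "t \<in> {0..<tau}"
    then have "t \<notin> T"
      using cInf_lower[OF _ bdd, of t] unfolding tau by auto
    then show "t \<in> ?S"
      using t * by (auto simp: T_def)
  qed
  ultimately have "closure {0..<tau} \<subseteq> ?S"
    by (rule closure_minimal[rotated])
  moreover have "tau \<in> closure {0..<tau}"
    using \<open>0 < tau\<close> by simp
  ultimately have "tau \<in> ?S"
    by (rule subsetD)
  then show "stoch_err D A lam u f xi tau \<le> approx_err D A lam u f xi tau"
    by simp
qed

lemma pred_loss_oracle_le: "pred_loss D A lam u f xi tau \<le> 4 * stoch_err D A lam u f xi tau"
  using pred_loss_le[OF balanced_oracle(1,2)] balanced_oracle(3) by simp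

text \<open>The random slope is traded for a deterministic level. If it is at most
  \<open>\<rho>\<close>, the stochastic bound is monotone in it. Otherwise the oracle is positive,
  the stochastic error is at most the approximation error, and the bias bound decreases in the
  slope.\<close>

lemma stoch_err_oracle_le:
  assumes mu: "0 < mu" and R: "source_norm D lam v mu f \<le> R" and \<rho>: "0 < \<rho>"
  shows "stoch_err D A lam u f xi tau \<le> (\<Sum>i\<in>{1..D}. min (\<rho> * (lam i)\<^sup>2) 1 * (e i)\<^sup>2)
    + R\<^sup>2 * (mu + 1/2) powr (2 * mu + 1) * \<rho> powr (- (2 * mu + 1))"
proof (cases "slope tau \<le> \<rho>")
  case True
  have "stoch_err D A lam u f xi tau \<le> (\<Sum>i\<in>{1..D}. min (slope tau * (lam i)\<^sup>2) 1 * (e i)\<^sup>2)"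
    by (rule stoch_err_le[OF balanced_oracle(1,2)])
  also have "\<dots> \<le> (\<Sum>i\<in>{1..D}. min (\<rho> * (lam i)\<^sup>2) 1 * (e i)\<^sup>2)"
    using True by (intro sum_mono mult_right_mono min.mono) auto
  also have "\<dots> \<le> \<dots> + R\<^sup>2 * (mu + 1/2) powr (2 * mu + 1) * \<rho> powr (- (2 * mu + 1))"
    by simp
  finally show ?thesis .
next
  case False
  then have "tau \<noteq> 0"
    using slope_0 \<rho> by auto
  then have "0 < tau"
    using balanced_oracle(1) by simp
  then have "stoch_err D A lam u f xi tau \<le> approx_err D A lam u f xi tau"
    by (rule balanced_oracle(4))
  also have "\<dots> \<le> R\<^sup>2 * (mu + 1/2) powr (2 * mu + 1) * slope tau powr (- (2 * mu + 1))"
    using bias_le[OF \<open>0 < tau\<close> balanced_oracle(2) mu R] .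
  also have "\<dots> \<le> R\<^sup>2 * (mu + 1/2) powr (2 * mu + 1) * \<rho> powr (- (2 * mu + 1))"
    using False \<rho> mu by (intro mult_left_mono powr_mono2') auto
  also have "\<dots> \<le> (\<Sum>i\<in>{1..D}. min (\<rho> * (lam i)\<^sup>2) 1 * (e i)\<^sup>2) + \<dots>"
    using \<rho> by (simp add: sum_nonneg)
  finally show ?thesis .
qed

end

section \<open>Expected risk at the balanced oracle\<close>

lemma scalar_prod_noise:
  fixes w :: "real vec"
  shows "w \<in> carrier_vec D \<Longrightarrow> scalar_prod (\<delta> \<cdot>\<^sub>v vec D z) w = \<delta> * (\<Sum>j<D. vec_index w j * z j)"
  unfolding scalar_prod_def sum_distrib_left lessThan_atLeast0
  by (intro sum.cong) (auto simp: mult_ac)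

text \<open>Each single coordinate of the observation is almost surely nonzero, as its noise part
  has a density.\<close>

lemma AE_nondegenerate:
  assumes u: "orthonormal_family D D u" and w: "A *\<^sub>v f \<in> carrier_vec D" and \<delta>: "\<delta> \<noteq> 0"
  shows "AE z in std_gaussian D. nondegenerate D lam u (observation A f (\<delta> \<cdot>\<^sub>v vec D z))"
proof -
  have "AE z in std_gaussian D. \<forall>i\<in>{1..D}.
      (\<Sum>j<D. vec_index (u i) j * z j) \<noteq> - scalar_prod (A *\<^sub>v f) (u i) / \<delta>"
  proof (rule AE_finite_allI)
    fix i assume i: "i \<in> {1..D}"
    then have "u i \<in> carrier_vec D" "scalar_prod (u i) (u i) = 1"
      using u by (auto simp: orthonormal_family_def)
    then show "AE z in std_gaussian D. (\<Sum>j<D. vec_index (u i) j * z j) \<noteq> - scalar_prod (A *\<^sub>v f) (u i) / \<delta>"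
      by (intro std_gaussian_AE_linear_neq) (simp add: scalar_prod_def lessThan_atLeast0 power2_eq_square)
  qed simp
  then show ?thesis
  proof eventually_elim
    case (elim z)
    have "0 < (scalar_prod (observation A f (\<delta> \<cdot>\<^sub>v vec D z)) (u i))\<^sup>2" if i: "i \<in> {1..D}" for i
    proof -
      have ui: "u i \<in> carrier_vec D"
        using u i by (auto simp: orthonormal_family_def)
      have "scalar_prod (observation A f (\<delta> \<cdot>\<^sub>v vec D z)) (u i)
          = scalar_prod (A *\<^sub>v f) (u i) + \<delta> * (\<Sum>j<D. vec_index (u i) j * z j)"
        unfolding observation_def scalar_prod_noise[OF ui, symmetric]
        using w ui by (intro add_scalar_prod_distrib) auto
      also have "\<dots> \<noteq> 0"
        using elim i \<delta> by (metis add.commute eq_neg_iff_add_eq_0 nonzero_mult_div_cancel_left)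
      finally show ?thesis
        by simp
    qed
    then show ?case
      unfolding nondegenerate_def
      by (intro ballI sum_pos2[of _ i for i]) auto
  qed
qed

lemma nn_integral_quadratic:
  assumes u: "orthonormal_family D D u" and m: "\<And>i. i \<in> {1..D} \<Longrightarrow> 0 \<le> m i" and b: "0 \<le> b"
  shows "(\<integral>\<^sup>+ z. ennreal ((\<Sum>i\<in>{1..D}. m i * (scalar_prod (\<delta> \<cdot>\<^sub>v vec D z) (u i))\<^sup>2) + b) \<partial>std_gaussian D)
    = ennreal (\<delta>\<^sup>2 * (\<Sum>i\<in>{1..D}. m i) + b)"
proof -
  interpret prob_space "std_gaussian D"
    by (rule prob_space_std_gaussian)
  define X where "X i z = (\<Sum>j<D. vec_index (u i) j * z j)" for i and z :: "nat \<Rightarrow> real"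
  have meas: "(\<lambda>z. ennreal ((X i z)\<^sup>2)) \<in> borel_measurable (std_gaussian D)" for i
    unfolding X_def by measurable
  have mom: "(\<integral>\<^sup>+ z. ennreal ((X i z)\<^sup>2) \<partial>std_gaussian D) = 1" if i: "i \<in> {1..D}" for i
  proof -
    have "u i \<in> carrier_vec D" "scalar_prod (u i) (u i) = 1"
      using u i by (auto simp: orthonormal_family_def)
    then show ?thesis
      unfolding X_def
      by (intro std_gaussian_second_moment) (simp add: scalar_prod_def lessThan_atLeast0 power2_eq_square)
  qed
  have "(\<Sum>i\<in>{1..D}. m i * (scalar_prod (\<delta> \<cdot>\<^sub>v vec D z) (u i))\<^sup>2) = (\<Sum>i\<in>{1..D}. m i * \<delta>\<^sup>2 * (X i z)\<^sup>2)" for z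
  proof (intro sum.cong refl)
    fix i assume "i \<in> {1..D}"
    then have "u i \<in> carrier_vec D"
      using u by (auto simp: orthonormal_family_def)
    then show "m i * (scalar_prod (\<delta> \<cdot>\<^sub>v vec D z) (u i))\<^sup>2 = m i * \<delta>\<^sup>2 * (X i z)\<^sup>2"
      unfolding scalar_prod_noise[OF \<open>u i \<in> carrier_vec D\<close>] X_def[symmetric]
      by (simp add: power_mult_distrib)
  qed
  moreover have "ennreal ((\<Sum>i\<in>{1..D}. m i * \<delta>\<^sup>2 * (X i z)\<^sup>2) + b)
      = (\<Sum>i\<in>{1..D}. ennreal (m i * \<delta>\<^sup>2) * ennreal ((X i z)\<^sup>2)) + ennreal b" for z
  proof -
    have "(\<Sum>i\<in>{1..D}. ennreal (m i * \<delta>\<^sup>2) * ennreal ((X i z)\<^sup>2))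
        = (\<Sum>i\<in>{1..D}. ennreal (m i * \<delta>\<^sup>2 * (X i z)\<^sup>2))"
      using m by (intro sum.cong refl) (simp add: ennreal_mult)
    also have "\<dots> = ennreal (\<Sum>i\<in>{1..D}. m i * \<delta>\<^sup>2 * (X i z)\<^sup>2)"
      using m by (intro sum_ennreal) auto
    finally show ?thesis
      using m b by (subst ennreal_plus) (auto intro!: sum_nonneg)
  qed
  ultimately have "(\<integral>\<^sup>+ z. ennreal ((\<Sum>i\<in>{1..D}. m i * (scalar_prod (\<delta> \<cdot>\<^sub>v vec D z) (u i))\<^sup>2) + b) \<partial>std_gaussian D)
      = (\<integral>\<^sup>+ z. (\<Sum>i\<in>{1..D}. ennreal (m i * \<delta>\<^sup>2) * ennreal ((X i z)\<^sup>2)) + ennreal b \<partial>std_gaussian D)"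
    by simp
  also have "\<dots> = (\<Sum>i\<in>{1..D}. ennreal (m i * \<delta>\<^sup>2)) + ennreal b"
    using meas by (simp add: nn_integral_add nn_integral_sum nn_integral_cmult mom emeasure_space_1)
  also have "(\<Sum>i\<in>{1..D}. ennreal (m i * \<delta>\<^sup>2)) = ennreal (\<delta>\<^sup>2 * (\<Sum>i\<in>{1..D}. m i))"
    using m by (subst sum_ennreal) (auto simp: sum_distrib_right mult.commute)
  also have "\<dots> + ennreal b = ennreal (\<delta>\<^sup>2 * (\<Sum>i\<in>{1..D}. m i) + b)"
    using m b by (subst ennreal_plus) (auto intro!: sum_nonneg mult_nonneg_nonneg)
  finally show ?thesis .
qed

text \<open>The sum is comparable with the number of indices for which the bound on the squared
  singular value exceeds 1/\<open>\<rho>\<close>. The condition \<open>1 \<le> \<rho>\<close>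
  absorbs the additive 1 into the power of \<open>\<rho>\<close>.\<close>

lemma effective_dimension_le:
  fixes p CA \<rho> :: real
  assumes lam: "\<And>i. i \<in> {1..D} \<Longrightarrow> 0 < lam i \<and> lam i \<le> CA * real i powr (- p)"
    and p: "1/2 < p" and CA: "0 < CA" and \<rho>: "1 \<le> \<rho>"
  shows "(\<Sum>i\<in>{1..D}. min (\<rho> * (lam i)\<^sup>2) 1)
    \<le> (CA powr (1/p) + 1) * (1 + 1/(2*p - 1)) * \<rho> powr (1/(2*p))"
proof -
  \<comment> \<open>The crossover index: \<open>\<rho>\<close> CA^2 i^(-2p) drops to 1 at i =
    \<open>N\<close>.\<close>
  define N where "N = (\<rho> * CA\<^sup>2) powr (1/(2*p))"
  have "0 < N"
    using \<rho> CA by (simp add: N_def)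
  have Nq: "N powr (2*p) = \<rho> * CA\<^sup>2"
    using \<rho> CA p by (simp add: N_def powr_powr)
  have "(\<Sum>i\<in>{1..D}. min (\<rho> * (lam i)\<^sup>2) 1) \<le> (\<Sum>i\<in>{1..D}. min (N powr (2*p) * real i powr (- (2*p))) 1)"
  proof (intro sum_mono min.mono order.refl)
    fix i assume i: "i \<in> {1..D}"
    have "(lam i)\<^sup>2 \<le> (CA * real i powr (- p))\<^sup>2"
      using lam[OF i] by (intro power_mono) auto
    also have "\<dots> = CA\<^sup>2 * real i powr (- (2*p))"
      using i by (simp add: power_mult_distrib power2_eq_square powr_add[symmetric])
    finally show "\<rho> * (lam i)\<^sup>2 \<le> N powr (2*p) * real i powr (- (2*p))"
      unfolding Nq using \<rho> by (simp add: mult.assoc mult_left_mono)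
  qed
  also have "\<dots> \<le> (N + 1) * (1 + 1/(2*p - 1))"
    using \<open>0 < N\<close> p by (intro sum_min_powr_le) auto
  also have "N + 1 \<le> (CA powr (1/p) + 1) * \<rho> powr (1/(2*p))"
  proof -
    have "CA\<^sup>2 = CA powr 2"
      using CA by simp
    then have "(CA\<^sup>2) powr (1/(2*p)) = CA powr (1/p)"
      by (simp only: powr_powr) simp
    then have "N = \<rho> powr (1/(2*p)) * CA powr (1/p)"
      using \<rho> CA by (simp add: N_def powr_mult)
    moreover have "1 \<le> \<rho> powr (1/(2*p))"
      using \<rho> p by (intro ge_one_powr_ge_zero) auto
    ultimately show ?thesis
      by (simp add: algebra_simps)
  qed
  finally show ?thesis
    using p by (simp add: mult_right_mono mult_ac)
qed

text \<open>Equating the variance rate with the bias rate gives \<open>\<rho>\<close>^(q/(2p)) =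
  (R/\<delta>)^2, because 1/(2p) + 2 mu + 1 = q/(2p). This determines \<open>\<rho>\<close>.\<close>

lemma rate_balance:
  fixes mu p R \<delta> :: real
  assumes "0 < mu" "0 < p" "0 < R" "0 < \<delta>"
  defines "q \<equiv> 4 * mu * p + 2 * p + 1"
  defines "\<rho> \<equiv> (R / \<delta>) powr (4 * p / q)"
  shows "\<delta>\<^sup>2 * \<rho> powr (1/(2*p)) = R powr (2/q) * \<delta> powr ((8 * mu * p + 4 * p)/q)"
    and "R\<^sup>2 * \<rho> powr (- (2 * mu + 1)) = R powr (2/q) * \<delta> powr ((8 * mu * p + 4 * p)/q)"
proof -
  have q: "0 < q"
    using assms by (simp add: q_def add_pos_pos)
  have \<rho>: "\<rho> powr s = R powr (4 * p / q * s) * \<delta> powr (- (4 * p / q * s))" for s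
    using assms(3,4) unfolding \<rho>_def powr_powr by (simp add: powr_divide powr_minus_divide)
  have sq: "\<delta>\<^sup>2 = \<delta> powr 2" "R\<^sup>2 = R powr 2"
    using assms by (simp_all add: powr_numeral)
  have e1: "4 * p / q * (1/(2*p)) = 2/q" and e2: "2 + - (2/q) = (8 * mu * p + 4 * p)/q"
    using assms q by (simp_all add: field_simps)
  have e5: "4 * p / q * (2 * mu + 1) = (8 * mu * p + 4 * p)/q"
    by (simp add: algebra_simps)
  then have e3: "- (4 * p / q * (- (2*mu+1))) = (8 * mu * p + 4 * p)/q"
    by (simp only: mult_minus_right minus_minus)
  have e4: "2 + 4 * p / q * (- (2*mu+1)) = 2/q"
    unfolding mult_minus_right e5 using e2 by linarith
  have "\<delta>\<^sup>2 * \<rho> powr (1/(2*p)) = R powr (2/q) * (\<delta> powr 2 * \<delta> powr (- (2/q)))"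
    unfolding \<rho> e1 sq by (simp only: mult_ac)
  then show "\<delta>\<^sup>2 * \<rho> powr (1/(2*p)) = R powr (2/q) * \<delta> powr ((8 * mu * p + 4 * p)/q)"
    unfolding powr_add[symmetric] e2 .
  have "R\<^sup>2 * \<rho> powr (- (2*mu+1)) = (R powr 2 * R powr (4 * p / q * (- (2*mu+1)))) * \<delta> powr (- (4 * p / q * (- (2*mu+1))))"
    unfolding \<rho> sq by (simp only: mult_ac)
  then show "R\<^sup>2 * \<rho> powr (- (2 * mu + 1)) = R powr (2/q) * \<delta> powr ((8 * mu * p + 4 * p)/q)"
    unfolding powr_add[symmetric] e3 e4 .
qed

text \<open>Both bounds hold pointwise outside a null set. The pointwise bound behind the second has
  deterministic weights, so its expectation involves only second moments, and the random oracle has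
  disappeared.\<close>

lemma gauss_expect_stoch_err_le:
  assumes model: "model D P A lam u v" and f: "f \<in> carrier_vec P" and \<delta>: "0 < \<delta>"
    and mu: "0 < mu" and R: "source_norm D lam v mu f \<le> R" and \<rho>: "0 < \<rho>"
  shows "gauss_expect D \<delta> (\<lambda>xi. pred_loss D A lam u f xi (balanced_oracle D A lam u f xi))
      \<le> 4 * gauss_expect D \<delta> (\<lambda>xi. stoch_err D A lam u f xi (balanced_oracle D A lam u f xi))"
    and "gauss_expect D \<delta> (\<lambda>xi. stoch_err D A lam u f xi (balanced_oracle D A lam u f xi))
      \<le> ennreal (\<delta>\<^sup>2 * (\<Sum>i\<in>{1..D}. min (\<rho> * (lam i)\<^sup>2) 1)
        + R\<^sup>2 * (mu + 1/2) powr (2 * mu + 1) * \<rho> powr (- (2 * mu + 1)))"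
proof -
  have u: "orthonormal_family D D u" and A: "A \<in> carrier_mat D P"
    using model by (auto simp: model_def singular_system_def)
  have Af: "A *\<^sub>v f \<in> carrier_vec D"
    using A f by simp
  define L where "L z = pred_loss D A lam u f (\<delta> \<cdot>\<^sub>v vec D z) (balanced_oracle D A lam u f (\<delta> \<cdot>\<^sub>v vec D z))" for z
  define S where "S z = stoch_err D A lam u f (\<delta> \<cdot>\<^sub>v vec D z) (balanced_oracle D A lam u f (\<delta> \<cdot>\<^sub>v vec D z))" for z
  define b where "b = R\<^sup>2 * (mu + 1/2) powr (2 * mu + 1) * \<rho> powr (- (2 * mu + 1))"
  have "AE z in std_gaussian D. nondegenerate D lam u (observation A f (\<delta> \<cdot>\<^sub>v vec D z))"
    using u Af \<delta> by (intro AE_nondegenerate) auto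
  then have AE_real: "AE z in std_gaussian D. cg_realisation D P A lam u v f (\<delta> \<cdot>\<^sub>v vec D z)"
    by eventually_elim (use model f in \<open>auto intro!: cg_realisation.intro\<close>)
  have "AE z in std_gaussian D. ennreal (L z) \<le> ennreal 4 * ennreal (S z)"
    using AE_real
  proof eventually_elim
    case (elim z)
    then have "L z \<le> 4 * S z"
      unfolding L_def S_def by (rule cg_realisation.pred_loss_oracle_le)
    then show ?case
      by (simp add: ennreal_mult'[symmetric] ennreal_leI del: ennreal_numeral)
  qed
  then have "(\<integral>\<^sup>+ z. ennreal (L z) \<partial>std_gaussian D) \<le> (\<integral>\<^sup>+ z. ennreal 4 * ennreal (S z) \<partial>std_gaussian D)"
    by (rule nn_integral_mono_AE)
  also have "\<dots> \<le> ennreal 4 * (\<integral>\<^sup>+ z. ennreal (S z) \<partial>std_gaussian D)"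
    by (rule nn_integral_cmult_le) simp
  finally show "gauss_expect D \<delta> (\<lambda>xi. pred_loss D A lam u f xi (balanced_oracle D A lam u f xi))
      \<le> 4 * gauss_expect D \<delta> (\<lambda>xi. stoch_err D A lam u f xi (balanced_oracle D A lam u f xi))"
    by (simp add: gauss_expect_def L_def S_def)
  have "AE z in std_gaussian D. ennreal (S z)
      \<le> ennreal ((\<Sum>i\<in>{1..D}. min (\<rho> * (lam i)\<^sup>2) 1 * (scalar_prod (\<delta> \<cdot>\<^sub>v vec D z) (u i))\<^sup>2) + b)"
    using AE_real
    by eventually_elim
      (auto intro!: ennreal_leI cg_realisation.stoch_err_oracle_le mu R \<rho> simp only: S_def b_def)
  then have "(\<integral>\<^sup>+ z. ennreal (S z) \<partial>std_gaussian D) \<le> (\<integral>\<^sup>+ z. ennreal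
      ((\<Sum>i\<in>{1..D}. min (\<rho> * (lam i)\<^sup>2) 1 * (scalar_prod (\<delta> \<cdot>\<^sub>v vec D z) (u i))\<^sup>2) + b) \<partial>std_gaussian D)"
    by (rule nn_integral_mono_AE)
  also have "\<dots> = ennreal (\<delta>\<^sup>2 * (\<Sum>i\<in>{1..D}. min (\<rho> * (lam i)\<^sup>2) 1) + b)"
    using \<rho> by (intro nn_integral_quadratic u) (auto simp: b_def)
  finally show "gauss_expect D \<delta> (\<lambda>xi. stoch_err D A lam u f xi (balanced_oracle D A lam u f xi))
      \<le> ennreal (\<delta>\<^sup>2 * (\<Sum>i\<in>{1..D}. min (\<rho> * (lam i)\<^sup>2) 1)
        + R\<^sup>2 * (mu + 1/2) powr (2 * mu + 1) * \<rho> powr (- (2 * mu + 1)))"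
    by (simp add: gauss_expect_def S_def b_def)
qed

lemma gauss_expect_stoch_err_rate:
  assumes model: "model D P A lam u v" and f: "f \<in> carrier_vec P" and \<delta>: "0 < \<delta>" "\<delta> < 1"
    and mu: "0 < mu" and R: "1 \<le> R" "source_norm D lam v mu f \<le> R"
    and p: "1/2 < p" and CA: "0 < CA" and lam: "\<forall>i\<in>{1..D}. lam i \<le> CA * real i powr (- p)"
  shows "4 * gauss_expect D \<delta> (\<lambda>xi. stoch_err D A lam u f xi (balanced_oracle D A lam u f xi))
    \<le> ennreal (4 * ((CA powr (1/p) + 1) * (1 + 1/(2*p - 1)) + (mu + 1/2) powr (2 * mu + 1))
        * R powr (2 / (4 * mu * p + 2 * p + 1))
        * \<delta> powr ((8 * mu * p + 4 * p) / (4 * mu * p + 2 * p + 1)))"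
proof -
  define q where "q = 4 * mu * p + 2 * p + 1"
  define \<rho> where "\<rho> = (R / \<delta>) powr (4 * p / q)"
  define K where "K = (CA powr (1/p) + 1) * (1 + 1/(2*p - 1))"
  define c where "c = (mu + 1/2) powr (2 * mu + 1)"
  define r where "r = R powr (2 / q) * \<delta> powr ((8 * mu * p + 4 * p) / q)"
  have "0 < q"
    using mu p by (simp add: q_def add_pos_pos)
  \<comment> \<open>R \<ge> 1 > \<delta> enters here; \<open>effective_dimension_le\<close> requires
    a level of at least 1.\<close>
  then have \<rho>: "1 \<le> \<rho>"
    unfolding \<rho>_def using R(1) \<delta> p by (intro ge_one_powr_ge_zero) auto
  have var_rate: "\<delta>\<^sup>2 * \<rho> powr (1/(2*p)) = r"
    unfolding r_def \<rho>_def q_def by (rule rate_balance(1)) (use mu p R(1) \<delta> in auto)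
  have bias_rate: "R\<^sup>2 * \<rho> powr (- (2 * mu + 1)) = r"
    unfolding r_def \<rho>_def q_def by (rule rate_balance(2)) (use mu p R(1) \<delta> in auto)
  have "0 < lam i" if "i \<in> {1..D}" for i
    using model that by (auto simp: model_def singular_system_def)
  then have "\<delta>\<^sup>2 * (\<Sum>i\<in>{1..D}. min (\<rho> * (lam i)\<^sup>2) 1) \<le> \<delta>\<^sup>2 * (K * \<rho> powr (1/(2*p)))"
    unfolding K_def using lam p CA \<rho> by (intro mult_left_mono effective_dimension_le) auto
  also have "\<dots> = K * r"
    unfolding var_rate[symmetric] by (simp only: mult_ac)
  finally have var: "\<delta>\<^sup>2 * (\<Sum>i\<in>{1..D}. min (\<rho> * (lam i)\<^sup>2) 1) \<le> K * r" .
  have bias: "R\<^sup>2 * c * \<rho> powr (- (2 * mu + 1)) = c * r"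
    unfolding bias_rate[symmetric] by (simp only: mult_ac)
  have "gauss_expect D \<delta> (\<lambda>xi. stoch_err D A lam u f xi (balanced_oracle D A lam u f xi))
      \<le> ennreal (\<delta>\<^sup>2 * (\<Sum>i\<in>{1..D}. min (\<rho> * (lam i)\<^sup>2) 1) + R\<^sup>2 * c * \<rho> powr (- (2 * mu + 1)))"
    unfolding c_def using model f \<delta>(1) mu R(2) \<rho> by (intro gauss_expect_stoch_err_le) auto
  also have "\<dots> \<le> ennreal ((K + c) * r)"
    unfolding bias using var by (intro ennreal_leI) (simp add: algebra_simps)
  finally have "4 * gauss_expect D \<delta> (\<lambda>xi. stoch_err D A lam u f xi (balanced_oracle D A lam u f xi))
      \<le> ennreal 4 * ennreal ((K + c) * r)"
    by (simp add: mult_left_mono)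
  also have "\<dots> = ennreal (4 * (K + c) * R powr (2 / q) * \<delta> powr ((8 * mu * p + 4 * p) / q))"
    by (subst ennreal_mult'[symmetric]) (auto simp: r_def algebra_simps)
  finally show ?thesis
    unfolding K_def c_def q_def .
qed

theorem theorem5p8:
  fixes mu :: real
  assumes "mu > 0"
  shows
    "(\<forall>(D::nat) (P::nat) (A::real mat) (lam::nat \<Rightarrow> real) (u::nat \<Rightarrow> real vec) (v::nat \<Rightarrow> real vec)
        (R::real) (f::real vec) (xi::real vec) (t::real).
        model D P A lam u v \<and> R \<ge> 1 \<and> f \<in> carrier_vec P \<and> source_norm D lam v mu f \<le> R \<and>
        xi \<in> carrier_vec D \<and> nondegenerate D lam u (observation A f xi) \<and>
        0 < t \<and> t \<le> real (num_distinct D lam) \<longrightarrow>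
        (let \<phi> = cg_slope D lam u (observation A f xi) t in
          pred_loss D A lam u f xi t
            \<le> 2 * R\<^sup>2 * (mu + 1/2) powr (2 * mu + 1) * \<phi> powr (- 2 * mu - 1)
              + 2 * sq_norm2 (fcalc D lam u (\<lambda>x. min (sqrt (\<phi> * x)) 1) xi)))
     \<and>
     (\<forall>(p::real) (CA::real). p > 1/2 \<and> CA > 0 \<longrightarrow>
        (\<exists>C::real. C > 0 \<and>
          (\<forall>(D::nat) (P::nat) (A::real mat) (lam::nat \<Rightarrow> real) (u::nat \<Rightarrow> real vec)
             (v::nat \<Rightarrow> real vec) (R::real) (f::real vec) (\<delta>::real).
             model D P A lam u v \<and> R \<ge> 1 \<and> f \<in> carrier_vec P \<and> source_norm D lam v mu f \<le> R \<and>
             (\<forall>i\<in>{1..D}. lam i \<le> CA * real i powr (- p)) \<and> 0 < \<delta> \<and> \<delta> < 1 \<longrightarrow>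
             gauss_expect D \<delta> (\<lambda>xi. pred_loss D A lam u f xi (balanced_oracle D A lam u f xi))
               \<le> 4 * gauss_expect D \<delta> (\<lambda>xi. stoch_err D A lam u f xi (balanced_oracle D A lam u f xi))
             \<and>
             4 * gauss_expect D \<delta> (\<lambda>xi. stoch_err D A lam u f xi (balanced_oracle D A lam u f xi))
               \<le> ennreal (C * R powr (2 / (4 * mu * p + 2 * p + 1))
                            * \<delta> powr ((8 * mu * p + 4 * p) / (4 * mu * p + 2 * p + 1))))))"
proof (intro conjI allI impI)
  fix D P A lam u v R f xi t
  assume "model D P A lam u v \<and> R \<ge> 1 \<and> f \<in> carrier_vec P \<and> source_norm D lam v mu f \<le> R \<and>
    xi \<in> carrier_vec D \<and> nondegenerate D lam u (observation A f xi) \<and>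
    0 < t \<and> t \<le> real (num_distinct D lam)"
  then show "let \<phi> = cg_slope D lam u (observation A f xi) t in
      pred_loss D A lam u f xi t
        \<le> 2 * R\<^sup>2 * (mu + 1/2) powr (2 * mu + 1) * \<phi> powr (- 2 * mu - 1)
          + 2 * sq_norm2 (fcalc D lam u (\<lambda>x. min (sqrt (\<phi> * x)) 1) xi)"
    unfolding Let_def using assms
    by (intro cg_realisation.loss_bound[of D P A lam u v]) (auto intro: cg_realisation.intro)
next
  fix p CA :: real
  assume pC: "p > 1/2 \<and> CA > 0"
  \<comment> \<open>Four times the sum of the variance and bias constants, built from mu, p and CA
    alone and so fixed before the dimensions.\<close>
  define C where "C = 4 * ((CA powr (1/p) + 1) * (1 + 1/(2*p - 1)) + (mu + 1/2) powr (2 * mu + 1))"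
  have "0 < C"
    unfolding C_def using pC by (intro mult_pos_pos add_pos_nonneg) (auto intro: add_nonneg_pos)
  show "\<exists>C::real. C > 0 \<and>
    (\<forall>(D::nat) (P::nat) (A::real mat) (lam::nat \<Rightarrow> real) (u::nat \<Rightarrow> real vec)
       (v::nat \<Rightarrow> real vec) (R::real) (f::real vec) (\<delta>::real).
       model D P A lam u v \<and> R \<ge> 1 \<and> f \<in> carrier_vec P \<and> source_norm D lam v mu f \<le> R \<and>
       (\<forall>i\<in>{1..D}. lam i \<le> CA * real i powr (- p)) \<and> 0 < \<delta> \<and> \<delta> < 1 \<longrightarrow>
       gauss_expect D \<delta> (\<lambda>xi. pred_loss D A lam u f xi (balanced_oracle D A lam u f xi))
         \<le> 4 * gauss_expect D \<delta> (\<lambda>xi. stoch_err D A lam u f xi (balanced_oracle D A lam u f xi))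
       \<and>
       4 * gauss_expect D \<delta> (\<lambda>xi. stoch_err D A lam u f xi (balanced_oracle D A lam u f xi))
         \<le> ennreal (C * R powr (2 / (4 * mu * p + 2 * p + 1))
                      * \<delta> powr ((8 * mu * p + 4 * p) / (4 * mu * p + 2 * p + 1))))"
  proof (intro exI[of _ C] conjI allI impI)
    show "0 < C"
      by fact
  next
    fix D P A lam u v f and R \<delta> :: real
    assume "model D P A lam u v \<and> R \<ge> 1 \<and> f \<in> carrier_vec P \<and> source_norm D lam v mu f \<le> R \<and>
      (\<forall>i\<in>{1..D}. lam i \<le> CA * real i powr (- p)) \<and> 0 < \<delta> \<and> \<delta> < 1"
    then show "gauss_expect D \<delta> (\<lambda>xi. pred_loss D A lam u f xi (balanced_oracle D A lam u f xi))
         \<le> 4 * gauss_expect D \<delta> (\<lambda>xi. stoch_err D A lam u f xi (balanced_oracle D A lam u f xi))"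
      \<comment> \<open>This inequality is independent of the comparison level; the value 1 is an
        arbitrary positive choice.\<close>
      using assms by (intro gauss_expect_stoch_err_le(1)[of D P A lam u v f \<delta> mu R 1]) auto
  next
    fix D P A lam u v f and R \<delta> :: real
    assume "model D P A lam u v \<and> R \<ge> 1 \<and> f \<in> carrier_vec P \<and> source_norm D lam v mu f \<le> R \<and>
      (\<forall>i\<in>{1..D}. lam i \<le> CA * real i powr (- p)) \<and> 0 < \<delta> \<and> \<delta> < 1"
    then show "4 * gauss_expect D \<delta> (\<lambda>xi. stoch_err D A lam u f xi (balanced_oracle D A lam u f xi))
         \<le> ennreal (C * R powr (2 / (4 * mu * p + 2 * p + 1))
                      * \<delta> powr ((8 * mu * p + 4 * p) / (4 * mu * p + 2 * p + 1)))"
      unfolding C_def using pC assms by (intro gauss_expect_stoch_err_rate) auto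
  qed
qed

end
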